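(* Let $m$ be a positive integer, let $a,c\in\mathbb{C}$, and let $I_m\subseteq D_m$ be the Muirhead ideal with parameters $a,c$, with Weyl closure $W(I_m)$. The (reduced) characteristic variety of $I_m$ is contained in the arrangement of the linear spaces $\widehat C_{J_0|J_1\ldots J_k}$: $$\mathrm{Char}(I_m)^{\mathrm{red}}\subseteq\bigcup_{[m]=J_0\sqcup J_1\sqcup\cdots\sqcup J_k}\widehat C_{J_0|J_1\ldots J_k},$$ where the union is over all partitions of $[m]=\{1,\ldots,m\}$ into a possibly empty distinguished set $J_0$ and (unordered) nonempty sets $J_1,\ldots,J_k$, $k\geq 0$. In particular, the same union also contains $\mathrm{Char}(W(I_m))^{\mathrm{red}}$.
   Context: $D_m=\mathbb{C}[x_1,\ldots,x_m]\langle\partial_1,\ldots,\partial_m\rangle$ is the $m$-th Weyl algebra and $R_m=\mathbb{C}(x_1,\ldots,x_m)\langle\partial_1,\ldots,\partial_m\rangle$ the ring of differential operators with rational function coefficients. A $D_m$-ideal is a left ideal of $D_m$. Muirhead ideal: for $k=1,\ldots,m$ put $$g_k=x_k\partial_k^2+(c-x_k)\partial_k+\frac12\Big(\sum_{\ell\neq k}\frac{x_\ell}{x_k-x_\ell}(\partial_k-\partial_\ell)\Big)-a\in R_m,\qquad P_k=\Big(\prod_{\ell\neq k}(x_k-x_\ell)\Big)g_k\in D_m.$$ Then $I_m$ is the left ideal of $D_m$ generated by $P_1,\ldots,P_m$. Weyl closure of a $D_m$-ideal $I$: $W(I)=(R_mI)\cap D_m$. Characteristic variety: for $P=\sum c_{\alpha\beta}x^\alpha\partial^\beta\in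 D_m$ nonzero of order $d=\max\{|\beta| : c_{\alpha\beta}\ne0\}$, put $\mathrm{in}_{(0,e)}(P)=\sum_{|\beta|=d}c_{\alpha\beta}x^\alpha\xi^\beta\in\mathbb{C}[x_1,\ldots,x_m,\xi_1,\ldots,\xi_m]$. For a $D_m$-ideal $I$, $\mathrm{in}_{(0,e)}(I)$ is the ideal generated by all $\mathrm{in}_{(0,e)}(P)$, $P\in I$, and $\mathrm{Char}(I)\subseteq T^*\mathbb{A}^m=\mathbb{A}^{2m}$ is the subscheme it defines; $\mathrm{Char}(I)^{\mathrm{red}}$ is the underlying reduced variety (the vanishing set). For a partition $[m]=J_0\sqcup J_1\sqcup\cdots\sqcup J_k$ as in the claim, $\widehat C_{J_0|J_1\ldots J_k}\subseteq\mathbb{A}^{2m}$ is the linear space $$V\Big(\{x_j\mid j\in J_0\}\cup\bigcup_{\ell=1}^k\{x_i-x_j\mid i,j\in J_\ell\}\cup\Big\{\sum_{i\in J_\ell}\xi_i\;\Big|\;\ell\in\{1,\ldots,k\}\text{ with }|J_\ell|\le2\Big\}\Big).$$ *)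

theory Defs
  imports
    Complex_Main
    "HOL-Library.Poly_Mapping"
    "HOL-Library.Disjoint_Sets"
    "HOL-Computational_Algebra.Fraction_Field"
begin

section \<open>Polynomials and rational functions\<close>

text \<open>
  The index set $[m]$ is the type \<open>'m\<close>, of sort \<open>{finite, linorder}\<close>, with $m =$ \<open>CARD('m)\<close>.
  The linear order is needed only because the library's integral domain instance for polynomials
  over a type of variables asks for it.
\<close>

type_synonym 'v mpoly = "('v \<Rightarrow>\<^sub>0 nat) \<Rightarrow>\<^sub>0 complex"

type_synonym 'm ratfun = "'m mpoly fract"

definition Var :: "'v \<Rightarrow> 'v mpoly" where
  "Var i = Poly_Mapping.single (Poly_Mapping.single i 1) 1"

definition Const :: "complex \<Rightarrow> 'v mpoly" where
  "Const c = Poly_Mapping.single 0 c"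

definition mpoly_eval :: "('v::finite \<Rightarrow> complex) \<Rightarrow> 'v mpoly \<Rightarrow> complex" where
  "mpoly_eval v p =
     (\<Sum>\<alpha>\<in>Poly_Mapping.keys p. Poly_Mapping.lookup p \<alpha> * (\<Prod>i\<in>UNIV. v i ^ Poly_Mapping.lookup \<alpha> i))"

definition zero_set :: "'v::finite mpoly set \<Rightarrow> ('v \<Rightarrow> complex) set" where
  "zero_set S = {v. \<forall>p\<in>S. mpoly_eval v p = 0}"

definition polyfun :: "'m::linorder mpoly \<Rightarrow> 'm ratfun" where
  "polyfun p = Fract p 1"

definition xvar :: "'m::linorder \<Rightarrow> 'm ratfun" where
  "xvar i = polyfun (Var i)"

definition cfun :: "complex \<Rightarrow> 'm::linorder ratfun" where
  "cfun c = polyfun (Const c)"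


lemma polyfun_add: "polyfun (p + q) = polyfun p + polyfun q"
  by (simp add: polyfun_def)

lemma polyfun_mult: "polyfun (p * q) = polyfun p * polyfun q"
  by (simp add: polyfun_def)

lemma polyfun_minus: "polyfun (- p) = - polyfun p"
  by (simp add: polyfun_def)

lemma polyfun_diff: "polyfun (p - q) = polyfun p - polyfun q"
  by (simp add: polyfun_def)

lemma polyfun_0 [simp]: "polyfun 0 = 0"
  by (simp add: polyfun_def Zero_fract_def)

lemma polyfun_1 [simp]: "polyfun 1 = 1"
  by (simp add: polyfun_def One_fract_def)

lemma inj_polyfun: "inj polyfun"
  by (rule injI) (simp add: polyfun_def eq_fract)


section \<open>Partial derivatives\<close>

lemma pm_sum_single:
  "(\<Sum>k\<in>Poly_Mapping.keys p. Poly_Mapping.single k (Poly_Mapping.lookup p k)) = p"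
  by (rule poly_mapping_eqI)
    (simp add: lookup_sum lookup_single when_def in_keys_iff sum.delta)

lemma pm_additive_induct [case_names zero single add]:
  assumes "P 0" "\<And>k v. P (Poly_Mapping.single k v)" "\<And>p q. P p \<Longrightarrow> P q \<Longrightarrow> P (p + q)"
  shows "P (p :: 'a \<Rightarrow>\<^sub>0 'b::comm_monoid_add)"
proof -
  have "P (\<Sum>k\<in>A. Poly_Mapping.single k (Poly_Mapping.lookup p k))" if "finite A" for A
    using that by induction (auto intro: assms)
  from this[of "Poly_Mapping.keys p"] show ?thesis by (simp add: pm_sum_single)
qed

definition mpderiv :: "'m \<Rightarrow> 'm mpoly \<Rightarrow> 'm mpoly" where
  "mpderiv i p = (\<Sum>\<alpha>\<in>Poly_Mapping.keys p.
     Poly_Mapping.single (\<alpha> - Poly_Mapping.single i 1)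
       (of_nat (Poly_Mapping.lookup \<alpha> i) * Poly_Mapping.lookup p \<alpha>))"

lemma mpderiv_zero [simp]: "mpderiv i 0 = 0"
  by (simp add: mpderiv_def)

lemma mpderiv_add: "mpderiv i (p + q) = mpderiv i p + mpderiv i q"
  unfolding mpderiv_def by (rule setsum_keys_plus_distrib) (simp_all add: ring_distribs single_add)

lemma mpderiv_single:
  "mpderiv i (Poly_Mapping.single \<alpha> c) =
     Poly_Mapping.single (\<alpha> - Poly_Mapping.single i 1) (of_nat (Poly_Mapping.lookup \<alpha> i) * c)"
  by (simp add: mpderiv_def)

lemma mpderiv_minus: "mpderiv i (- p) = - mpderiv i p"
  using mpderiv_add[of i p "- p"] by (simp add: eq_neg_iff_add_eq_0 add.commute)

lemma mpderiv_diff: "mpderiv i (p - q) = mpderiv i p - mpderiv i q"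
  using mpderiv_add[of i p "- q"] by (simp add: mpderiv_minus)

lemma mpderiv_one [simp]: "mpderiv i 1 = 0"
  using mpderiv_single[of i 0 1] by simp

lemma mpderiv_Const [simp]: "mpderiv i (Const c) = 0"
  by (simp add: Const_def mpderiv_single)

lemma mpderiv_Var: "mpderiv i (Var j) = (if i = j then 1 else 0)"
  by (auto simp: Var_def mpderiv_single lookup_single when_def)

lemma mono_sub_add:
  fixes \<alpha> \<beta> :: "'m \<Rightarrow>\<^sub>0 nat"
  assumes "Poly_Mapping.lookup \<alpha> i > 0"
  shows "\<alpha> - Poly_Mapping.single i 1 + \<beta> = \<alpha> + \<beta> - Poly_Mapping.single i 1"
  using assms
  by (intro poly_mapping_eqI) (auto simp: lookup_add lookup_minus lookup_single when_def)

lemma mpderiv_mult: "mpderiv i (p * q) = mpderiv i p * q + p * mpderiv i q"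
proof (induction p rule: pm_additive_induct)
  case (single \<alpha> a)
  show ?case
  proof (induction q rule: pm_additive_induct)
    case (single \<beta> b)
    let ?e = "Poly_Mapping.single i 1 :: 'a \<Rightarrow>\<^sub>0 nat"
    have A: "Poly_Mapping.single (\<alpha> - ?e + \<beta>) (of_nat (Poly_Mapping.lookup \<alpha> i) * a * b)
        = Poly_Mapping.single (\<alpha> + \<beta> - ?e) (of_nat (Poly_Mapping.lookup \<alpha> i) * a * b)"
      using mono_sub_add[of \<alpha> i \<beta>] by (cases "Poly_Mapping.lookup \<alpha> i = 0") auto
    have B: "Poly_Mapping.single (\<alpha> + (\<beta> - ?e)) (a * (of_nat (Poly_Mapping.lookup \<beta> i) * b))
        = Poly_Mapping.single (\<alpha> + \<beta> - ?e) (a * (of_nat (Poly_Mapping.lookup \<beta> i) * b))"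
      using mono_sub_add[of \<beta> i \<alpha>]
      by (cases "Poly_Mapping.lookup \<beta> i = 0") (auto simp: add.commute)
    show ?case
      by (simp only: mult_single mpderiv_single A B lookup_add single_add[symmetric])
        (simp add: algebra_simps)
  qed (simp_all add: mpderiv_add algebra_simps)
qed (simp_all add: mpderiv_add algebra_simps)

lemma mpderiv_commute: "mpderiv i (mpderiv j p) = mpderiv j (mpderiv i p)"
proof (induction p rule: pm_additive_induct)
  case (single \<alpha> a)
  have "\<alpha> - Poly_Mapping.single j 1 - Poly_Mapping.single i 1
      = \<alpha> - Poly_Mapping.single i 1 - Poly_Mapping.single j (1::nat)"
    by (intro poly_mapping_eqI) (auto simp: lookup_minus)
  then show ?case
    by (cases "i = j") (simp_all add: mpderiv_single lookup_minus lookup_single mult_ac)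
qed (simp_all add: mpderiv_add)

lifting_forget poly_mapping.lifting

lemma quotient_rule_respects:
  fixes p :: "'a::comm_ring_1"
  assumes eq: "p * q' = p' * q" and d: "dp * q' + p * dq' = dp' * q + p' * dq"
  shows "(dp * q - p * dq) * (q' * q') = (dp' * q' - p' * dq') * (q * q)"
proof -
  have "(dp * q - p * dq) * (q' * q') - (dp' * q' - p' * dq') * (q * q)
      = q * q' * ((dp * q' + p * dq') - (dp' * q + p' * dq))
        - (q * dq' + dq * q') * (p * q' - p' * q)"
    by (simp add: algebra_simps)
  also have "\<dots> = 0"
    by (simp only: eq d diff_self mult_zero_right)
  finally show ?thesis by simp
qed

lift_definition rderiv :: "'m::linorder \<Rightarrow> 'm ratfun \<Rightarrow> 'm ratfun"
  is "\<lambda>i (p, q). (mpderiv i p * q - p * mpderiv i q, q * q)"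
proof -
  fix i :: 'm and P Q :: "'m mpoly \<times> 'm mpoly"
  obtain p q p' q' where PQ: "P = (p, q)" "Q = (p', q')" by fastforce
  assume "fractrel P Q"
  then have nz: "q \<noteq> 0" "q' \<noteq> 0" and eq: "p * q' = p' * q" by (auto simp: PQ)
  have d: "mpderiv i p * q' + p * mpderiv i q' = mpderiv i p' * q + p' * mpderiv i q"
    using arg_cong[OF eq, of "mpderiv i"] by (simp add: mpderiv_mult)
  note quot = quotient_rule_respects[OF eq d]
  from nz quot show "fractrel (case P of (p, q) \<Rightarrow> (mpderiv i p * q - p * mpderiv i q, q * q))
      (case Q of (p, q) \<Rightarrow> (mpderiv i p * q - p * mpderiv i q, q * q))"
    by (simp only: PQ case_prod_conv fractrel_iff fst_conv snd_conv mult_eq_0_iff simp_thms)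
qed

lemma rderiv_Fract:
  "q \<noteq> 0 \<Longrightarrow> rderiv i (Fract p q) = Fract (mpderiv i p * q - p * mpderiv i q) (q * q)"
  by transfer simp

lemma rderiv_polyfun: "rderiv i (polyfun p) = polyfun (mpderiv i p)"
  by (simp add: polyfun_def rderiv_Fract)

lemma ratfun_cases:
  obtains p q where "q \<noteq> 0" "f * polyfun q = polyfun p"
  by (cases f) (auto simp: polyfun_def eq_fract)

lemma polyfun_eq_0_iff [simp]: "polyfun p = 0 \<longleftrightarrow> p = 0"
  using inj_eq[OF inj_polyfun, of p 0] by simp

lemma rderiv_key:
  assumes "q \<noteq> 0" "f * polyfun q = polyfun p"
  shows "rderiv i f * polyfun q + f * polyfun (mpderiv i q) = polyfun (mpderiv i p)"
proof -
  have f: "f = Fract p q"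
    using assms
    by (cases f) (simp add: polyfun_def eq_fract)
  have key: "(dp * q - p * dq) * q * q + p * dq * (q * q) = dp * (q * q * q)"
    for p q dp dq :: "'b::comm_ring_1"
    by (simp add: algebra_simps)
  from assms(1) have "q * q \<noteq> 0" "q * q * q \<noteq> 0"
    by simp_all
  with assms(1) show ?thesis
    unfolding f rderiv_Fract[OF assms(1)] polyfun_def
    by (simp only: mult_fract mult_1_right add_fract eq_fract one_neq_zero not_False_eq_True key)
qed

lemma rderiv_unique:
  assumes "q \<noteq> 0" "f * polyfun q = polyfun p"
    "g * polyfun q + f * polyfun (mpderiv i q) = polyfun (mpderiv i p)"
  shows "rderiv i f = g"
proof -
  have "rderiv i f * polyfun q = g * polyfun q"
    by (rule add_right_imp_eq[OF trans[OF rderiv_key[OF assms(1,2)] assms(3)[symmetric]]])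
  with assms(1) show ?thesis by simp
qed

lemma rderiv_add: "rderiv i (f + g) = rderiv i f + rderiv i g"
proof -
  obtain p q where f: "q \<noteq> 0" "f * polyfun q = polyfun p" by (rule ratfun_cases)
  obtain r s where g: "s \<noteq> 0" "g * polyfun s = polyfun r" by (rule ratfun_cases)
  have sum_key: "(f' + g') * (Q * S) + (f + g) * (Q' * S + Q * S')
      = (f' * Q + f * Q') * S + f * Q * S' + ((g' * S + g * S') * Q + g * S * Q')"
    for f g f' g' Q S Q' S' :: "'b::comm_ring_1"
    by (simp add: algebra_simps)
  note kf = rderiv_key[OF f, of i, symmetric] and kg = rderiv_key[OF g, of i, symmetric]
  show ?thesis
  proof (rule rderiv_unique)
    show "q * s \<noteq> 0" using f g by simp
    show "(f + g) * polyfun (q * s) = polyfun (p * s + r * q)"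
      by (simp add: polyfun_mult polyfun_add f(2)[symmetric] g(2)[symmetric] algebra_simps)
    show "(rderiv i f + rderiv i g) * polyfun (q * s) + (f + g) * polyfun (mpderiv i (q * s))
        = polyfun (mpderiv i (p * s + r * q))"
      unfolding polyfun_mult polyfun_add mpderiv_mult mpderiv_add kf kg f(2)[symmetric]
        g(2)[symmetric] by (rule sum_key)
  qed
qed

lemma rderiv_mult: "rderiv i (f * g) = rderiv i f * g + f * rderiv i g"
proof -
  obtain p q where f: "q \<noteq> 0" "f * polyfun q = polyfun p" by (rule ratfun_cases)
  obtain r s where g: "s \<noteq> 0" "g * polyfun s = polyfun r" by (rule ratfun_cases)
  have prod_key: "(f' * g + f * g') * (Q * S) + f * g * (Q' * S + Q * S')
      = (f' * Q + f * Q') * (g * S) + f * Q * (g' * S + g * S')"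
    for f g f' g' Q S Q' S' :: "'b::comm_ring_1"
    by (simp add: algebra_simps)
  note kf = rderiv_key[OF f, of i, symmetric] and kg = rderiv_key[OF g, of i, symmetric]
  show ?thesis
  proof (rule rderiv_unique)
    show "q * s \<noteq> 0" using f g by simp
    show "f * g * polyfun (q * s) = polyfun (p * r)"
      by (simp add: polyfun_mult f(2)[symmetric] g(2)[symmetric] algebra_simps)
    show "(rderiv i f * g + f * rderiv i g) * polyfun (q * s) + f * g * polyfun (mpderiv i (q * s))
        = polyfun (mpderiv i (p * r))"
      unfolding polyfun_mult polyfun_add mpderiv_mult kf kg f(2)[symmetric] g(2)[symmetric]
      by (rule prod_key)
  qed
qed

lemma rderiv_zero [simp]: "rderiv i 0 = 0"
  using rderiv_add[of i 0 0] by (metis add_0_right add_left_cancel)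

lemma rderiv_one [simp]: "rderiv i 1 = 0"
  using rderiv_mult[of i 1 1] by (metis add_0_right add_left_cancel mult_1 mult_1_right)

lemma rderiv_xvar: "rderiv i (xvar j) = (if i = j then 1 else 0)"
  by (simp add: xvar_def rderiv_polyfun mpderiv_Var)

lemma rderiv_commute: "rderiv i (rderiv j f) = rderiv j (rderiv i f)"
proof -
  obtain p q where nz: "q \<noteq> 0" and *: "f * polyfun q = polyfun p" by (rule ratfun_cases)
  have "rderiv i (rderiv j (f * polyfun q)) = rderiv j (rderiv i (f * polyfun q))"
    by (simp add: * rderiv_polyfun mpderiv_commute[of i j])
  moreover have "rderiv i (rderiv j (polyfun q)) = rderiv j (rderiv i (polyfun q))"
    by (simp add: rderiv_polyfun mpderiv_commute[of i j])
  ultimately have "rderiv i (rderiv j f) * polyfun q = rderiv j (rderiv i f) * polyfun q"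
    by (simp add: rderiv_mult rderiv_add algebra_simps)
  with nz show ?thesis by simp
qed


section \<open>The ring of differential operators with rational function coefficients\<close>

text \<open>
  An element of $R_m$ is a finite sum $\sum_\beta f_\beta \partial^\beta$ with $f_\beta \in
  \mathbb{C}(x_1,\ldots,x_m)$, represented by the family of its coefficients \<open>f\<close>.
  The product is determined by left linearity over the rational functions and by
  $\partial_i \cdot \sum_\beta f_\beta\partial^\beta =
   \sum_\beta (f_\beta\partial^{\beta+e_i} + (\partial f_\beta/\partial x_i)\,\partial^\beta)$,
  which is the operator \<open>dleft\<close> below.
\<close>

type_synonym 'm opcoeffs = "('m \<Rightarrow>\<^sub>0 nat) \<Rightarrow>\<^sub>0 'm ratfun"

definition dleft :: "'m::linorder \<Rightarrow> 'm opcoeffs \<Rightarrow> 'm opcoeffs" where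
  "dleft i P = (\<Sum>\<beta>\<in>Poly_Mapping.keys P.
     Poly_Mapping.single (\<beta> + Poly_Mapping.single i 1) (Poly_Mapping.lookup P \<beta>)
     + Poly_Mapping.single \<beta> (rderiv i (Poly_Mapping.lookup P \<beta>)))"

definition dleft_pow :: "('m::{finite,linorder} \<Rightarrow>\<^sub>0 nat) \<Rightarrow> 'm opcoeffs \<Rightarrow> 'm opcoeffs" where
  "dleft_pow \<beta> P =
     fold (\<lambda>i. dleft i ^^ Poly_Mapping.lookup \<beta> i) (sorted_list_of_set UNIV) P"

definition fleft :: "'m::linorder ratfun \<Rightarrow> 'm opcoeffs \<Rightarrow> 'm opcoeffs" where
  "fleft f P = Poly_Mapping.map ((*) f) P"

definition opmult :: "'m::{finite,linorder} opcoeffs \<Rightarrow> 'm opcoeffs \<Rightarrow> 'm opcoeffs" where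
  "opmult P Q = (\<Sum>\<beta>\<in>Poly_Mapping.keys P. fleft (Poly_Mapping.lookup P \<beta>) (dleft_pow \<beta> Q))"

lemma lookup_fleft: "Poly_Mapping.lookup (fleft f P) \<beta> = f * Poly_Mapping.lookup P \<beta>"
  unfolding fleft_def by (simp add: Poly_Mapping.map.rep_eq when_def)

lemma fleft_simps [simp]:
  "fleft 0 P = 0" "fleft 1 P = P" "fleft f 0 = 0"
  "fleft f (P + Q) = fleft f P + fleft f Q"
  "fleft (f + g) P = fleft f P + fleft g P"
  "fleft f (fleft g P) = fleft (f * g) P"
  "fleft f (Poly_Mapping.single \<beta> g) = Poly_Mapping.single \<beta> (f * g)"
  by (rule poly_mapping_eqI;
      simp add: lookup_fleft lookup_add lookup_single when_def algebra_simps)+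

lemma dleft_zero [simp]: "dleft i 0 = 0"
  by (simp add: dleft_def)

lemma dleft_add: "dleft i (P + Q) = dleft i P + dleft i Q"
  unfolding dleft_def
  by (rule setsum_keys_plus_distrib) (simp_all add: single_add rderiv_add add_ac)

lemma dleft_single:
  "dleft i (Poly_Mapping.single \<beta> f) =
     Poly_Mapping.single (\<beta> + Poly_Mapping.single i 1) f + Poly_Mapping.single \<beta> (rderiv i f)"
  by (simp add: dleft_def)

lemma dleft_fleft: "dleft i (fleft f P) = fleft f (dleft i P) + fleft (rderiv i f) P"
  by (induction P rule: pm_additive_induct)
    (simp_all add: dleft_add dleft_single rderiv_mult single_add algebra_simps)

lemma dleft_commute: "dleft i (dleft j P) = dleft j (dleft i P)"
  by (induction P rule: pm_additive_induct)
    (simp_all add: dleft_add dleft_single add_ac rderiv_commute[of i j])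

lemma dleft_funpow_commute: "(dleft i ^^ n) (dleft j P) = dleft j ((dleft i ^^ n) P)"
  by (induction n) (simp_all add: dleft_commute[of i j])

lemma dleft_fold_commute:
  "fold (\<lambda>i. dleft i ^^ h i) xs (dleft j P) = dleft j (fold (\<lambda>i. dleft i ^^ h i) xs P)"
  by (induction xs arbitrary: P) (simp_all add: dleft_funpow_commute)

lemma dleft_pow_dleft: "dleft_pow \<beta> (dleft i P) = dleft i (dleft_pow \<beta> P)"
  by (simp add: dleft_pow_def dleft_fold_commute)

lemma dleft_fold_update:
  "distinct xs \<Longrightarrow> fold (\<lambda>j. dleft j ^^ (h j + (if j = i then 1 else 0))) xs P =
     (if i \<in> set xs then dleft i (fold (\<lambda>j. dleft j ^^ h j) xs P) 
      else fold (\<lambda>j. dleft j ^^ h j) xs P)"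
  by (induction xs arbitrary: P) (auto simp: dleft_fold_commute)

lemma dleft_pow_Suc: "dleft_pow (\<beta> + Poly_Mapping.single i 1) P = dleft i (dleft_pow \<beta> P)"
proof -
  have "(\<lambda>j. dleft j ^^ Poly_Mapping.lookup (\<beta> + Poly_Mapping.single i 1) j)
      = (\<lambda>j. dleft j ^^ (Poly_Mapping.lookup \<beta> j + (if j = i then 1 else 0)))"
    by (auto simp: lookup_add lookup_single when_def)
  then show ?thesis
    unfolding dleft_pow_def
    by (simp only: dleft_fold_update[OF distinct_sorted_list_of_set]) simp
qed

lemma dleft_pow_0 [simp]: "dleft_pow 0 P = P"
proof -
  have "fold (\<lambda>i. dleft i ^^ Poly_Mapping.lookup 0 i) xs P = P" for xs
    by (induction xs) auto
  then show ?thesis by (simp add: dleft_pow_def)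
qed

lemma mono_induct [case_names zero suc]:
  fixes \<beta> :: "'m \<Rightarrow>\<^sub>0 nat"
  assumes "P 0" "\<And>\<beta> i. P \<beta> \<Longrightarrow> P (\<beta> + Poly_Mapping.single i 1)"
  shows "P \<beta>"
proof -
  have "P (\<gamma> + Poly_Mapping.single k v)" if "P \<gamma>" for \<gamma> k v
  proof (induction v)
    case (Suc v)
    have "\<gamma> + Poly_Mapping.single k (Suc v) = \<gamma> + Poly_Mapping.single k v + Poly_Mapping.single k 1"
      by (simp add: add.assoc single_add[symmetric])
    with assms(2)[OF Suc] show ?case by simp
  qed (use that in simp)
  then have "\<forall>\<gamma>. P \<gamma> \<longrightarrow> P (\<gamma> + \<beta>)"
    by (induction \<beta> rule: pm_additive_induct) (auto simp flip: add.assoc)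
  with assms(1) show ?thesis by (metis add_0)
qed

lemma dleft_pow_add: "dleft_pow \<beta> (P + Q) = dleft_pow \<beta> P + dleft_pow \<beta> Q"
  by (induction \<beta> rule: mono_induct) (simp_all add: dleft_pow_Suc[simplified] dleft_add)

lemma dleft_pow_zero [simp]: "dleft_pow \<beta> 0 = 0"
  by (induction \<beta> rule: mono_induct) (simp_all add: dleft_pow_Suc[simplified])

lemma dleft_pow_single:
  "dleft_pow \<beta> (Poly_Mapping.single \<gamma> 1) = Poly_Mapping.single (\<beta> + \<gamma>) 1"
  by (induction \<beta> rule: mono_induct) (simp_all add: dleft_pow_Suc[simplified] dleft_single add_ac)

lemma opmult_zero [simp]: "opmult 0 Q = 0" "opmult P 0 = 0"
  by (simp_all add: opmult_def)

lemma opmult_add_left: "opmult (P + P') Q = opmult P Q + opmult P' Q"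
  unfolding opmult_def by (rule setsum_keys_plus_distrib) simp_all

lemma opmult_add_right: "opmult P (Q + Q') = opmult P Q + opmult P Q'"
  by (simp add: opmult_def dleft_pow_add sum.distrib)

lemma opmult_single: "opmult (Poly_Mapping.single \<beta> f) Q = fleft f (dleft_pow \<beta> Q)"
  by (simp add: opmult_def)

lemma opmult_one_left: "opmult (Poly_Mapping.single 0 1) Q = Q"
  using opmult_single[of 0 1 Q] by simp

lemma opmult_one_right: "opmult P (Poly_Mapping.single 0 1) = P"
  by (induction P rule: pm_additive_induct)
    (simp_all add: opmult_add_left opmult_single dleft_pow_single[of _ 0, simplified])

lemma opmult_fleft: "opmult (fleft f P) Q = fleft f (opmult P Q)"
  by (induction P rule: pm_additive_induct) (simp_all add: opmult_add_left opmult_single)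

lemma opmult_dleft: "opmult (dleft i P) Q = dleft i (opmult P Q)"
  by (induction P rule: pm_additive_induct)
    (simp_all add: opmult_add_left opmult_single dleft_single dleft_add dleft_fleft
      dleft_pow_Suc[simplified])

lemma opmult_dleft_pow: "opmult (dleft_pow \<beta> P) Q = dleft_pow \<beta> (opmult P Q)"
  by (induction \<beta> rule: mono_induct) (simp_all add: dleft_pow_Suc[simplified] opmult_dleft)

lemma opmult_assoc: "opmult (opmult P Q) S = opmult P (opmult Q S)"
  by (induction P rule: pm_additive_induct)
    (simp_all add: opmult_add_left opmult_single opmult_fleft opmult_dleft_pow)

typedef (overloaded) 'm diffop = "UNIV :: 'm::{finite,linorder} opcoeffs set"
  morphisms coeffs Diffop ..

setup_lifting type_definition_diffop

instantiation diffop :: ("{finite,linorder}") ring_1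
begin

lift_definition zero_diffop :: "'a diffop" is 0 .
lift_definition one_diffop :: "'a diffop" is "Poly_Mapping.single 0 1" .
lift_definition plus_diffop :: "'a diffop \<Rightarrow> 'a diffop \<Rightarrow> 'a diffop" is "(+)" .
lift_definition minus_diffop :: "'a diffop \<Rightarrow> 'a diffop \<Rightarrow> 'a diffop" is "(-)" .
lift_definition uminus_diffop :: "'a diffop \<Rightarrow> 'a diffop" is uminus .
lift_definition times_diffop :: "'a diffop \<Rightarrow> 'a diffop \<Rightarrow> 'a diffop" is opmult .

instance
proof
  fix a b c :: "'a diffop"
  show "a * b * c = a * (b * c)" by transfer (rule opmult_assoc)
  show "1 * a = a" by transfer (rule opmult_one_left)
  show "a * 1 = a" by transfer (rule opmult_one_right)
  show "a + b + c = a + (b + c)" by transfer (rule add.assoc)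
  show "a + b = b + a" by transfer (rule add.commute)
  show "0 + a = a" by transfer simp
  show "- a + a = 0" by transfer simp
  show "a - b = a + - b" by transfer simp
  show "(a + b) * c = a * c + b * c" by transfer (rule opmult_add_left)
  show "a * (b + c) = a * b + a * c" by transfer (rule opmult_add_right)
  show "(0::'a diffop) \<noteq> 1" by transfer (metis lookup_single_eq lookup_zero zero_neq_one)
qed

end

lifting_forget fract.lifting

lift_definition rfun :: "'m::{finite,linorder} ratfun \<Rightarrow> 'm diffop"
  is "\<lambda>f. Poly_Mapping.single 0 f" .

lift_definition pdop :: "'m::{finite,linorder} \<Rightarrow> 'm diffop"
  is "\<lambda>i. Poly_Mapping.single (Poly_Mapping.single i 1) 1" .

lemma rfun_add: "rfun (f + g) = rfun f + rfun g"
  by transfer (simp add: single_add)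

lemma rfun_mult: "rfun (f * g) = rfun f * rfun g"
  by transfer (simp add: opmult_single)

lemma coeffs_rfun_mult:
  "Poly_Mapping.lookup (coeffs (rfun f * P)) \<beta> = f * Poly_Mapping.lookup (coeffs P) \<beta>"
  by transfer (simp add: opmult_single lookup_fleft)

lemma pdop_rfun: "pdop i * rfun f = rfun f * pdop i + rfun (rderiv i f)"
proof transfer
  fix i :: 'a and f :: "'a ratfun"
  have "dleft_pow (Poly_Mapping.single i 1) P = dleft i P" for P
    using dleft_pow_Suc[of 0 i P] by simp
  then show "opmult (Poly_Mapping.single (Poly_Mapping.single i 1) 1) (Poly_Mapping.single 0 f)
      = opmult (Poly_Mapping.single 0 f) (Poly_Mapping.single (Poly_Mapping.single i 1) 1)
        + Poly_Mapping.single 0 (rderiv i f)"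
    by (simp add: opmult_single dleft_single)
qed

lemma pdop_commute: "pdop i * pdop j = pdop j * pdop i"
  by transfer (simp add: opmult_single dleft_pow_single add.commute)


section \<open>The Weyl algebra\<close>

definition weyl :: "'m::{finite,linorder} diffop set" where
  "weyl = {P. \<forall>\<beta>. Poly_Mapping.lookup (coeffs P) \<beta> \<in> range polyfun}"

lemma polyfun_prod: "polyfun (prod h A) = (\<Prod>i\<in>A. polyfun (h i))"
  by (induction A rule: infinite_finite_induct) (simp_all add: polyfun_mult)

lemma weyl_0: "0 \<in> weyl"
  unfolding weyl_def by transfer (use polyfun_0 in force)

lemma weyl_add: "P \<in> weyl \<Longrightarrow> Q \<in> weyl \<Longrightarrow> P + Q \<in> weyl"
  unfolding weyl_def by transfer (auto simp: lookup_add image_iff, metis polyfun_add)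

lemma weyl_minus: "P \<in> weyl \<Longrightarrow> - P \<in> weyl"
  unfolding weyl_def by transfer (auto simp: image_iff, metis polyfun_minus)

lemma weyl_diff: "P \<in> weyl \<Longrightarrow> Q \<in> weyl \<Longrightarrow> P - Q \<in> weyl"
  using weyl_add[OF _ weyl_minus, of P Q] by simp

lemma weyl_sum: "(\<And>i. i \<in> A \<Longrightarrow> h i \<in> weyl) \<Longrightarrow> sum h A \<in> weyl"
  by (induction A rule: infinite_finite_induct) (auto intro: weyl_0 weyl_add)

lemma weyl_polyfun: "rfun (polyfun p) \<in> weyl"
  unfolding weyl_def
  by transfer (auto simp: lookup_single when_def intro: range_eqI[of _ _ 0])

lemma weyl_1: "1 \<in> weyl"
proof -
  have "rfun (polyfun 1) = (1 :: 'a diffop)" by (simp, transfer) simp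
  then show ?thesis by (metis weyl_polyfun)
qed

lemma weyl_pdop: "pdop i \<in> weyl"
  unfolding weyl_def
  by transfer (auto simp: lookup_single when_def intro: range_eqI[of _ _ 0] range_eqI[of _ _ 1])

lemma weyl_mult:
  assumes "P \<in> weyl" "Q \<in> weyl"
  shows "P * Q \<in> weyl"
proof -
  define W :: "'a opcoeffs set" where "W = {P. \<forall>\<beta>. Poly_Mapping.lookup P \<beta> \<in> range polyfun}"
  have W0: "0 \<in> W" by (auto simp: W_def intro: range_eqI[of _ _ 0])
  have Wadd: "A + B \<in> W" if "A \<in> W" "B \<in> W" for A B
    using that by (auto simp: W_def lookup_add image_iff, metis polyfun_add)
  have Wsum: "(\<And>i. i \<in> A \<Longrightarrow> h i \<in> W) \<Longrightarrow> sum h A \<in> W" for h and A :: "('a \<Rightarrow>\<^sub>0 nat) set"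
    by (induction A rule: infinite_finite_induct) (auto intro: W0 Wadd)
  have Wsingle: "Poly_Mapping.single \<beta> f \<in> W" if "f \<in> range polyfun" for \<beta> f
    using that by (auto simp: W_def lookup_single when_def intro: range_eqI[of _ _ 0])
  have Wf: "fleft f A \<in> W" if "f \<in> range polyfun" "A \<in> W" for f A
    using that by (auto simp: W_def lookup_fleft image_iff, metis polyfun_mult)
  have Wd: "dleft i A \<in> W" if "A \<in> W" for i A
    unfolding dleft_def using that
    by (intro Wsum Wadd Wsingle) (auto simp: W_def image_iff, metis rderiv_polyfun)
  have Wdp: "dleft_pow \<beta> A \<in> W" if "A \<in> W" for \<beta> A
    using that by (induction \<beta> rule: mono_induct) (simp_all add: dleft_pow_Suc[simplified] Wd)
  have "opmult A B \<in> W" if "A \<in> W" "B \<in> W" for A B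
    unfolding opmult_def using that by (intro Wsum Wf Wdp) (auto simp: W_def)
  with assms show ?thesis unfolding weyl_def W_def by transfer auto
qed


section \<open>Left ideals, Weyl closure and characteristic variety\<close>

definition left_ideal :: "'r::ring_1 set \<Rightarrow> 'r set \<Rightarrow> bool" where
  "left_ideal A J \<longleftrightarrow> J \<subseteq> A \<and> 0 \<in> J \<and> (\<forall>x\<in>J. \<forall>y\<in>J. x + y \<in> J) \<and> (\<forall>r\<in>A. \<forall>x\<in>J. r * x \<in> J)"

text \<open>
  The left ideal of the subring \<open>A\<close> generated by a subset \<open>S\<close> of \<open>A\<close> (meaningful only
  for \<open>S \<subseteq> A\<close>). For a commutative ring and \<open>A = UNIV\<close> it is the ideal generated by \<open>S\<close>.
\<close>

definition left_ideal_gen :: "'r::ring_1 set \<Rightarrow> 'r set \<Rightarrow> 'r set" where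
  "left_ideal_gen A S = \<Inter>{J. left_ideal A J \<and> S \<subseteq> J}"

definition weyl_closure :: "'m::{finite,linorder} diffop set \<Rightarrow> 'm diffop set" where
  "weyl_closure I = left_ideal_gen UNIV I \<inter> weyl"

definition op_order :: "'m::{finite,linorder} diffop \<Rightarrow> nat" where
  "op_order P = Max ((\<lambda>\<beta>. \<Sum>i\<in>UNIV. Poly_Mapping.lookup \<beta> i) ` Poly_Mapping.keys (coeffs P))"

text \<open>For \<open>P\<close> in the Weyl algebra, the polynomial coefficient of $\partial^\beta$.\<close>

definition poly_coeff :: "'m::{finite,linorder} diffop \<Rightarrow> ('m \<Rightarrow>\<^sub>0 nat) \<Rightarrow> 'm mpoly" where
  "poly_coeff P \<beta> = (THE p. polyfun p = Poly_Mapping.lookup (coeffs P) \<beta>)"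

text \<open>
  The coordinates of $T^*\mathbb{A}^m = \mathbb{A}^{2m}$ are indexed by \<open>'m + 'm\<close>:
  \<open>Inl i\<close> stands for $x_i$ and \<open>Inr i\<close> for $\xi_i$.
\<close>

definition in_symbol :: "'m::{finite,linorder} diffop \<Rightarrow> ('m + 'm) mpoly" where
  "in_symbol P =
     (\<Sum>\<beta> | \<beta> \<in> Poly_Mapping.keys (coeffs P) \<and> (\<Sum>i\<in>UNIV. Poly_Mapping.lookup \<beta> i) = op_order P.
        \<Sum>\<alpha>\<in>Poly_Mapping.keys (poly_coeff P \<beta>).
          Const (Poly_Mapping.lookup (poly_coeff P \<beta>) \<alpha>)
          * (\<Prod>i\<in>UNIV. Var (Inl i) ^ Poly_Mapping.lookup \<alpha> i)
          * (\<Prod>i\<in>UNIV. Var (Inr i) ^ Poly_Mapping.lookup \<beta> i))"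

definition in_ideal :: "'m::{finite,linorder} diffop set \<Rightarrow> ('m + 'm) mpoly set" where
  "in_ideal I = left_ideal_gen UNIV {in_symbol P | P. P \<in> I \<and> P \<noteq> 0}"

text \<open>The closed points of the characteristic variety, that is, $\mathrm{Char}(I)^{\mathrm{red}}$.\<close>

definition char_variety :: "'m::{finite,linorder} diffop set \<Rightarrow> ('m + 'm \<Rightarrow> complex) set" where
  "char_variety I = zero_set (in_ideal I)"


section \<open>The Muirhead ideal\<close>

definition muirhead_g :: "complex \<Rightarrow> complex \<Rightarrow> 'm::{finite,linorder} \<Rightarrow> 'm diffop" where
  "muirhead_g a c k =
     rfun (xvar k) * pdop k ^ 2 + rfun (cfun c - xvar k) * pdop k
     + rfun (cfun (1/2)) *
         (\<Sum>l\<in>UNIV - {k}. rfun (xvar l / (xvar k - xvar l)) * (pdop k - pdop l))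
     - rfun (cfun a)"

definition muirhead_P :: "complex \<Rightarrow> complex \<Rightarrow> 'm::{finite,linorder} \<Rightarrow> 'm diffop" where
  "muirhead_P a c k = rfun (\<Prod>l\<in>UNIV - {k}. xvar k - xvar l) * muirhead_g a c k"

definition muirhead_ideal :: "complex \<Rightarrow> complex \<Rightarrow> 'm::{finite,linorder} diffop set" where
  "muirhead_ideal a c = left_ideal_gen weyl (range (muirhead_P a c))"

lemma xvar_eq_iff: "xvar i = xvar j \<longleftrightarrow> i = j"
  using rderiv_xvar[of i i] rderiv_xvar[of i j] by (auto split: if_splits)

lemma muirhead_P_in_weyl: "muirhead_P a c k \<in> weyl"
proof -
  let ?d = "\<lambda>l. Var k - Var l :: 'a mpoly"
  define p where "p = (\<Prod>l\<in>UNIV - {k}. ?d l)"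
  have p: "(\<Prod>l\<in>UNIV - {k}. xvar k - xvar l) = polyfun p"
    by (simp add: p_def polyfun_prod polyfun_diff xvar_def)
  have term_in: "rfun (polyfun p) * (rfun (cfun (1/2)) *
      (rfun (xvar l / (xvar k - xvar l)) * (pdop k - pdop l))) \<in> weyl" if "l \<noteq> k" for l
  proof -
    define q where "q = (\<Prod>j\<in>UNIV - {k} - {l}. ?d j)"
    have "p = ?d l * q"
      unfolding p_def q_def using that by (subst prod.remove[of _ l]) auto
    then have pq: "polyfun p = (xvar k - xvar l) * polyfun q"
      by (simp add: polyfun_mult polyfun_diff xvar_def)
    have nz: "xvar k - xvar l \<noteq> 0"
      using that by (simp add: xvar_eq_iff)
    have "polyfun p * cfun (1/2) * (xvar l / (xvar k - xvar l))
        = polyfun (q * Const (1/2) * Var l)"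
      unfolding pq using nz by (simp add: polyfun_mult cfun_def xvar_def)
    then have "rfun (polyfun p) * (rfun (cfun (1/2)) *
        (rfun (xvar l / (xvar k - xvar l)) * (pdop k - pdop l)))
        = rfun (polyfun (q * Const (1/2) * Var l)) * (pdop k - pdop l)"
      by (metis mult.assoc rfun_mult)
    then show ?thesis by (simp add: weyl_mult weyl_diff weyl_pdop weyl_polyfun)
  qed
  have "rfun (polyfun p) * (rfun (xvar k) * pdop k ^ 2) \<in> weyl"
    "rfun (polyfun p) * (rfun (cfun c - xvar k) * pdop k) \<in> weyl"
    "rfun (polyfun p) * rfun (cfun a) \<in> weyl"
    by (simp_all add: power2_eq_square xvar_def cfun_def weyl_mult weyl_polyfun weyl_pdop
        flip: polyfun_diff)
  moreover have "rfun (polyfun p) * (rfun (cfun (1/2)) *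
      (\<Sum>l\<in>UNIV - {k}. rfun (xvar l / (xvar k - xvar l)) * (pdop k - pdop l))) \<in> weyl"
    by (simp only: sum_distrib_left) (rule weyl_sum, rule term_in, simp)
  moreover have "A * (B + C + D - E) = A * B + A * C + A * D - A * E" for A B C D E :: "'a diffop"
    by (simp add: algebra_simps)
  ultimately show ?thesis
    unfolding muirhead_P_def muirhead_g_def p by (simp only:) (intro weyl_diff weyl_add)
qed


section \<open>The linear spaces\<close>

definition C_hat :: "'m::finite set \<Rightarrow> 'm set set \<Rightarrow> ('m + 'm \<Rightarrow> complex) set" where
  "C_hat J0 \<J> = zero_set
     ({Var (Inl j) | j. j \<in> J0}
      \<union> (\<Union>J\<in>\<J>. {Var (Inl i) - Var (Inl j) | i j. i \<in> J \<and> j \<in> J})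
      \<union> {\<Sum>i\<in>J. Var (Inr i) | J. J \<in> \<J> \<and> card J \<le> 2})"

end

theory Submission
  imports Defs
begin

text \<open>
  Given a point $(x, \xi)$ of the characteristic variety, let $J_0$ be the set of indices with
  $x_j = 0$ and let the other blocks collect the indices with equal coordinates. Only blocks of
  size at most two impose a condition on $\xi$. All computations take place locally at $x$: an
  operator with coefficients regular at $x$ that lies in the ideal after multiplication by a
  polynomial not vanishing at $x$ has a symbol vanishing at $(x, \xi)$.

  For a block $\{k\}$ the operator $g_k$ is regular at $x$ and has symbol $x_k \xi_k^2$.

  For a block $\{i, j\}$ put $y = x_i - x_j$, $z = x_i + x_j$, $\theta_k = x_k\partial_k$,
  $S = \theta_i + \theta_j$ and $T = \theta_i - \theta_j$. The poles along $y = 0$ cancel in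
  $H = x_i g_i - x_j g_j = TS + \alpha T + yC$, while $2y(x_i g_i + x_j g_j) = yN$ with
  $yN = y(S^2 + T^2 + b) + zT$; here $b$ and $C$ are regular of order at most one and $\alpha$ is a
  regular function. Since $S$ commutes with $T$, the combination
  $(S - 1 + \alpha)\,yN - T\,yH$ equals $yM$ with $M = S^3 + {}$(terms of order at most two).
  Finally $T\,yM - (S-1)^2\,yH = zM + y\cdot{}$(an operator of order at most three), whose symbol
  at a point with $x_i = x_j$ is $2 x_i \cdot x_i^3 (\xi_i + \xi_j)^3$.
\<close>

section \<open>Evaluation of polynomials and rational functions\<close>

lemma mpoly_eval_zero [simp]: "mpoly_eval v 0 = 0"
  by (simp add: mpoly_eval_def)

lemma mpoly_eval_add: "mpoly_eval v (p + q) = mpoly_eval v p + mpoly_eval v q"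
  unfolding mpoly_eval_def by (rule setsum_keys_plus_distrib) (simp_all add: algebra_simps)

lemma mpoly_eval_single:
  "mpoly_eval v (Poly_Mapping.single \<alpha> a) = a * (\<Prod>i\<in>UNIV. v i ^ Poly_Mapping.lookup \<alpha> i)"
  by (simp add: mpoly_eval_def)

lemma mpoly_eval_mult: "mpoly_eval v (p * q) = mpoly_eval v p * mpoly_eval v q"
proof (induction p rule: pm_additive_induct)
  case (single \<alpha> a)
  show ?case
    by (induction q rule: pm_additive_induct)
      (simp_all add: mpoly_eval_add mpoly_eval_single mult_single lookup_add power_add prod.distrib
        algebra_simps)
qed (simp_all add: mpoly_eval_add algebra_simps)

lemma mpoly_eval_one [simp]: "mpoly_eval v 1 = 1"
  using mpoly_eval_single[of v 0 1] by simp

lemma mpoly_eval_Const [simp]: "mpoly_eval v (Const a) = a"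
  by (simp add: Const_def mpoly_eval_single)

lemma mpoly_eval_Var [simp]: "mpoly_eval v (Var i) = v i"
proof -
  have "(\<Prod>j\<in>UNIV. v j ^ Poly_Mapping.lookup (Poly_Mapping.single i (1::nat)) j)
      = (\<Prod>j\<in>UNIV. if j = i then v j else 1)"
    by (intro prod.cong) (auto simp: lookup_single when_def)
  then show ?thesis by (simp add: Var_def mpoly_eval_single)
qed

lemma mpoly_eval_minus: "mpoly_eval v (- p) = - mpoly_eval v p"
  using mpoly_eval_add[of v p "- p"] by (simp add: eq_neg_iff_add_eq_0 add.commute)

lemma mpoly_eval_diff: "mpoly_eval v (p - q) = mpoly_eval v p - mpoly_eval v q"
  using mpoly_eval_add[of v p "- q"] by (simp add: mpoly_eval_minus)

lemma mpoly_eval_sum: "mpoly_eval v (sum h A) = (\<Sum>i\<in>A. mpoly_eval v (h i))"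
  by (induction A rule: infinite_finite_induct) (simp_all add: mpoly_eval_add)

lemma mpoly_eval_prod: "mpoly_eval v (prod h A) = (\<Prod>i\<in>A. mpoly_eval v (h i))"
  by (induction A rule: infinite_finite_induct) (simp_all add: mpoly_eval_mult)

lemma mpoly_eval_power: "mpoly_eval v (p ^ n) = mpoly_eval v p ^ n"
  by (induction n) (simp_all add: mpoly_eval_mult)

section \<open>Rational functions regular at a point and their values\<close>

text \<open>A relation, so that no reduced fraction has to be chosen: any representation
  \<open>p / q\<close> with \<open>q\<close> nonzero at \<open>x\<close> may serve as
  witness.\<close>

definition takes_value :: "('m::{finite,linorder} \<Rightarrow> complex) \<Rightarrow> 'm ratfun \<Rightarrow> complex \<Rightarrow> bool" where
  "takes_value x f t \<longleftrightarrow> (\<exists>p q. mpoly_eval x q \<noteq> 0 \<and> f * polyfun q = polyfun p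
     \<and> mpoly_eval x p = t * mpoly_eval x q)"

definition regular_at :: "('m::{finite,linorder} \<Rightarrow> complex) \<Rightarrow> 'm ratfun \<Rightarrow> bool" where
  "regular_at x f \<longleftrightarrow> (\<exists>t. takes_value x f t)"

text \<open>Outside the local ring at \<open>x\<close> the value is unspecified; regularity is
  therefore always tracked along with it.\<close>

definition value_at :: "('m::{finite,linorder} \<Rightarrow> complex) \<Rightarrow> 'm ratfun \<Rightarrow> complex" where
  "value_at x f = (THE t. takes_value x f t)"

text \<open>Cross multiplication turns two representations of \<open>f\<close> into an identity of
  polynomials, which can be evaluated.\<close>

lemma takes_value_unique:
  assumes "takes_value x f s" "takes_value x f t"
  shows "s = t"
proof -
  obtain p q where 1: "mpoly_eval x q \<noteq> 0" "f * polyfun q = polyfun p"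
      "mpoly_eval x p = s * mpoly_eval x q"
    using assms(1) by (auto simp: takes_value_def)
  obtain p' q' where 2: "mpoly_eval x q' \<noteq> 0" "f * polyfun q' = polyfun p'"
      "mpoly_eval x p' = t * mpoly_eval x q'"
    using assms(2) by (auto simp: takes_value_def)
  have "polyfun (p * q') = polyfun (p' * q)"
    by (simp add: polyfun_mult 1(2)[symmetric] 2(2)[symmetric])
  then have "p * q' = p' * q" by (rule injD[OF inj_polyfun])
  then have "mpoly_eval x p * mpoly_eval x q' = mpoly_eval x p' * mpoly_eval x q"
    by (metis mpoly_eval_mult)
  with 1 2 show ?thesis by simp
qed

lemma value_at_eqI: "takes_value x f t \<Longrightarrow> value_at x f = t"
  unfolding value_at_def by (blast intro: takes_value_unique)

lemma takes_value_value_at: "regular_at x f \<Longrightarrow> takes_value x f (value_at x f)"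
  using value_at_eqI by (fastforce simp: regular_at_def)

lemma takes_value_polyfun: "takes_value x (polyfun p) (mpoly_eval x p)"
  unfolding takes_value_def by (rule exI[of _ p], rule exI[of _ 1]) simp

lemma takes_value_xvar: "takes_value x (xvar i) (x i)"
  using takes_value_polyfun[of x "Var i"] by (simp add: xvar_def)

lemma takes_value_cfun: "takes_value x (cfun a) a"
  using takes_value_polyfun[of x "Const a"] by (simp add: cfun_def)

lemma takes_value_0: "takes_value x 0 0"
  using takes_value_polyfun[of x 0] by simp

lemma takes_value_1: "takes_value x 1 1"
  using takes_value_polyfun[of x 1] by simp

lemma takes_value_add:
  assumes "takes_value x f s" "takes_value x g t"
  shows "takes_value x (f + g) (s + t)"
proof -
  obtain p q where 1: "mpoly_eval x q \<noteq> 0" "f * polyfun q = polyfun p"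
      "mpoly_eval x p = s * mpoly_eval x q"
    using assms(1) by (auto simp: takes_value_def)
  obtain p' q' where 2: "mpoly_eval x q' \<noteq> 0" "g * polyfun q' = polyfun p'"
      "mpoly_eval x p' = t * mpoly_eval x q'"
    using assms(2) by (auto simp: takes_value_def)
  show ?thesis
    unfolding takes_value_def
    by (rule exI[of _ "p * q' + p' * q"], rule exI[of _ "q * q'"])
      (use 1 2 in \<open>simp add: polyfun_mult polyfun_add mpoly_eval_mult mpoly_eval_add algebra_simps
        flip: 1(2) 2(2)\<close>)
qed

lemma takes_value_mult:
  assumes "takes_value x f s" "takes_value x g t"
  shows "takes_value x (f * g) (s * t)"
proof -
  obtain p q where 1: "mpoly_eval x q \<noteq> 0" "f * polyfun q = polyfun p"
      "mpoly_eval x p = s * mpoly_eval x q"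
    using assms(1) by (auto simp: takes_value_def)
  obtain p' q' where 2: "mpoly_eval x q' \<noteq> 0" "g * polyfun q' = polyfun p'"
      "mpoly_eval x p' = t * mpoly_eval x q'"
    using assms(2) by (auto simp: takes_value_def)
  show ?thesis
    unfolding takes_value_def
    by (rule exI[of _ "p * p'"], rule exI[of _ "q * q'"])
      (use 1 2 in \<open>simp add: polyfun_mult mpoly_eval_mult algebra_simps flip: 1(2) 2(2)\<close>)
qed

lemma takes_value_minus: "takes_value x f s \<Longrightarrow> takes_value x (- f) (- s)"
  using takes_value_mult[OF takes_value_polyfun[of x "- 1"], of f s]
  by (simp add: polyfun_minus mpoly_eval_minus)

lemma takes_value_diff:
  "takes_value x f s \<Longrightarrow> takes_value x g t \<Longrightarrow> takes_value x (f - g) (s - t)"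
  using takes_value_add[OF _ takes_value_minus, of x f s g t] by simp

text \<open>A nonzero value means that the numerator does not vanish at \<open>x\<close> and can
  become the denominator.\<close>

lemma takes_value_inverse:
  assumes "takes_value x f s" "s \<noteq> 0"
  shows "takes_value x (inverse f) (inverse s)"
proof -
  obtain p q where 1: "mpoly_eval x q \<noteq> 0" "f * polyfun q = polyfun p"
      "mpoly_eval x p = s * mpoly_eval x q"
    using assms(1) by (auto simp: takes_value_def)
  have "p \<noteq> 0" using 1 assms(2) by auto
  then have "f \<noteq> 0" using 1(2) by auto
  then show ?thesis
    unfolding takes_value_def using 1 assms(2)
    by (intro exI[of _ q] exI[of _ p]) (simp add: field_simps flip: 1(2))
qed

lemma takes_value_divide:
  "takes_value x f s \<Longrightarrow> takes_value x g t \<Longrightarrow> t \<noteq> 0 \<Longrightarrow> takes_value x (f / g) (s / t)"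
  using takes_value_mult[OF _ takes_value_inverse] by (simp add: divide_inverse)

lemma regular_atI: "takes_value x f t \<Longrightarrow> regular_at x f"
  by (auto simp: regular_at_def)

text \<open>By the quotient rule \<open>q * q\<close> is a denominator of the derivative, and it
  does not vanish at \<open>x\<close> if \<open>q\<close> does not.\<close>

lemma regular_at_rderiv:
  assumes "regular_at x f"
  shows "regular_at x (rderiv i f)"
proof -
  obtain p q where 1: "mpoly_eval x q \<noteq> 0" "f * polyfun q = polyfun p"
    using assms by (auto simp: regular_at_def takes_value_def)
  then have "q \<noteq> 0" by auto
  have "rderiv i f * polyfun (q * q) = polyfun (mpderiv i p * q - p * mpderiv i q)"
    unfolding polyfun_mult polyfun_diff rderiv_key[OF \<open>q \<noteq> 0\<close> 1(2), of i, symmetric]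
      1(2)[symmetric]
    by (simp only: algebra_simps add_diff_cancel)
  with 1(1) show ?thesis
    unfolding regular_at_def takes_value_def
    by (intro exI[of _ "mpoly_eval x (mpderiv i p * q - p * mpderiv i q) / mpoly_eval x (q * q)"]
        exI[of _ "mpderiv i p * q - p * mpderiv i q"] exI[of _ "q * q"])
      (simp add: mpoly_eval_mult)
qed

lemma regular_at_add: "regular_at x f \<Longrightarrow> regular_at x g \<Longrightarrow> regular_at x (f + g)"
  by (auto simp: regular_at_def intro: takes_value_add)

lemma regular_at_mult: "regular_at x f \<Longrightarrow> regular_at x g \<Longrightarrow> regular_at x (f * g)"
  by (auto simp: regular_at_def intro: takes_value_mult)

lemma regular_at_diff: "regular_at x f \<Longrightarrow> regular_at x g \<Longrightarrow> regular_at x (f - g)"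
  by (auto simp: regular_at_def intro: takes_value_diff)

lemma regular_at_xvar: "regular_at x (xvar i)"
  by (rule regular_atI[OF takes_value_xvar])

lemma regular_at_cfun: "regular_at x (cfun a)"
  by (rule regular_atI[OF takes_value_cfun])

lemma regular_at_1: "regular_at x 1"
  by (rule regular_atI[OF takes_value_1])

lemma regular_at_0 [simp]: "regular_at x 0"
  by (rule regular_atI[OF takes_value_0])

lemma regular_at_sum: "(\<And>i. i \<in> A \<Longrightarrow> regular_at x (h i)) \<Longrightarrow> regular_at x (sum h A)"
  by (induction A rule: infinite_finite_induct) (auto intro: regular_at_add)

lemma regular_at_pole:
  assumes "x l \<noteq> x k" and f: "regular_at x f"
  shows "regular_at x (f / (xvar k - xvar l))"
  by (rule regular_atI[OF takes_value_divide[OF takes_value_value_at[OF f]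
          takes_value_diff[OF takes_value_xvar takes_value_xvar]]]) (use assms(1) in auto)

lemma value_at_0 [simp]: "value_at x 0 = 0"
  by (rule value_at_eqI[OF takes_value_0])

lemma value_at_add:
  "regular_at x f \<Longrightarrow> regular_at x g \<Longrightarrow> value_at x (f + g) = value_at x f + value_at x g"
  by (intro value_at_eqI takes_value_add takes_value_value_at)

lemma value_at_mult:
  "regular_at x f \<Longrightarrow> regular_at x g \<Longrightarrow> value_at x (f * g) = value_at x f * value_at x g"
  by (intro value_at_eqI takes_value_mult takes_value_value_at)


section \<open>Symbols at a point of the cotangent bundle\<close>

abbreviation mdeg :: "('m::finite \<Rightarrow>\<^sub>0 nat) \<Rightarrow> nat" where
  "mdeg \<beta> \<equiv> (\<Sum>i\<in>UNIV. Poly_Mapping.lookup \<beta> i)"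

text \<open>An exponent vector of degree \<open>d\<close> has entries at most \<open>d\<close>.
  Finiteness matters because sums over infinite sets are 0 by convention.\<close>

lemma finite_mdeg_eq: "finite {\<beta> :: 'm::finite \<Rightarrow>\<^sub>0 nat. mdeg \<beta> = d}"
proof -
  have "finite (PiE (UNIV :: 'm set) (\<lambda>_. {..d}))" by (intro finite_PiE) auto
  then have "finite (Poly_Mapping.lookup -` PiE (UNIV :: 'm set) (\<lambda>_. {..d}))"
    by (rule finite_vimageI) (simp add: inj_on_def)
  then show ?thesis
    by (rule rev_finite_subset) (auto intro!: member_le_sum[of _ UNIV "Poly_Mapping.lookup _"])
qed

lemma mdeg_add_single: "mdeg (\<beta> + Poly_Mapping.single i 1) = Suc (mdeg \<beta>)"
  by (simp add: lookup_add sum.distrib lookup_single when_def)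

lemma prod_power_add_single:
  fixes h :: "'m::finite \<Rightarrow> complex"
  shows "(\<Prod>j\<in>UNIV. h j ^ Poly_Mapping.lookup (\<beta> + Poly_Mapping.single i 1) j)
    = h i * (\<Prod>j\<in>UNIV. h j ^ Poly_Mapping.lookup \<beta> j)"
proof -
  have "(\<Prod>j\<in>UNIV. h j ^ Poly_Mapping.lookup (Poly_Mapping.single i (1::nat)) j)
      = (\<Prod>j\<in>UNIV. if j = i then h j else 1)"
    by (intro prod.cong) (auto simp: lookup_single when_def)
  then show ?thesis by (simp add: lookup_add power_add prod.distrib)
qed

text \<open>
  The order bound \<open>d\<close> is not assumed to be attained: below order \<open>d\<close> the symbol is \<open>0\<close>.
\<close>

definition has_symbol ::
  "('m + 'm \<Rightarrow> complex) \<Rightarrow> nat \<Rightarrow> 'm::{finite,linorder} diffop \<Rightarrow> complex \<Rightarrow> bool" where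
  "has_symbol v d P s \<longleftrightarrow>
     (\<forall>\<beta>. regular_at (v \<circ> Inl) (Poly_Mapping.lookup (coeffs P) \<beta>))
     \<and> (\<forall>\<beta>. d < mdeg \<beta> \<longrightarrow> Poly_Mapping.lookup (coeffs P) \<beta> = 0)
     \<and> s = (\<Sum>\<beta> | mdeg \<beta> = d. value_at (v \<circ> Inl) (Poly_Mapping.lookup (coeffs P) \<beta>)
              * (\<Prod>i\<in>UNIV. v (Inr i) ^ Poly_Mapping.lookup \<beta> i))"

lemma lookup_coeffs_add:
  "Poly_Mapping.lookup (coeffs (P + Q)) \<beta>
     = Poly_Mapping.lookup (coeffs P) \<beta> + Poly_Mapping.lookup (coeffs Q) \<beta>"
  by transfer (simp add: lookup_add)

lemma has_symbol_add:
  "has_symbol v d P s \<Longrightarrow> has_symbol v d Q t \<Longrightarrow> has_symbol v d (P + Q) (s + t)"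
  unfolding has_symbol_def
  by (auto simp: lookup_coeffs_add regular_at_add value_at_add distrib_right sum.distrib)

lemma has_symbol_rfun_mult:
  assumes f: "takes_value (v \<circ> Inl) f t" and P: "has_symbol v d P s"
  shows "has_symbol v d (rfun f * P) (t * s)"
  using P regular_atI[OF f] value_at_eqI[OF f] unfolding has_symbol_def
  by (auto simp: coeffs_rfun_mult regular_at_mult value_at_mult sum_distrib_left mult.assoc)

lemma rfun_0 [simp]: "rfun 0 = 0"
  by transfer simp

lemma rfun_1 [simp]: "rfun 1 = 1"
  by transfer simp

lemma rfun_minus: "rfun (- f) = - rfun f"
  using rfun_add[of f "- f"] by (simp add: eq_neg_iff_add_eq_0 add.commute)

lemma rfun_diff: "rfun (f - g) = rfun f - rfun g"
  using rfun_add[of f "- g"] by (simp add: rfun_minus)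

lemma has_symbol_minus:
  assumes "has_symbol v d P s"
  shows "has_symbol v d (- P) (- s)"
proof -
  have "rfun (- 1) * P = - P" by (simp add: rfun_minus)
  with has_symbol_rfun_mult[OF takes_value_minus[OF takes_value_1] assms] show ?thesis by simp
qed

lemma has_symbol_diff:
  "has_symbol v d P s \<Longrightarrow> has_symbol v d Q t \<Longrightarrow> has_symbol v d (P - Q) (s - t)"
  using has_symbol_add[OF _ has_symbol_minus, of v d P s Q t] by simp

lemma has_symbol_weaken: "has_symbol v d P s \<Longrightarrow> d < e \<Longrightarrow> has_symbol v e P 0"
  unfolding has_symbol_def by (auto intro!: sum.neutral)

lemma has_symbol_0: "has_symbol v d 0 0"
proof -
  have "Poly_Mapping.lookup (coeffs 0) \<beta> = 0" for \<beta> :: "'a \<Rightarrow>\<^sub>0 nat" by transfer simp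
  then show ?thesis by (simp add: has_symbol_def)
qed

lemma has_symbol_1: "has_symbol v 0 1 1"
proof -
  have 1: "Poly_Mapping.lookup (coeffs 1) \<beta> = (if \<beta> = 0 then 1 else 0)" for \<beta> :: "'a \<Rightarrow>\<^sub>0 nat"
    by transfer (auto simp: lookup_single when_def simp del: single_one)
  have "{\<beta> :: 'a \<Rightarrow>\<^sub>0 nat. mdeg \<beta> = 0} = {0}"
    by (auto intro!: poly_mapping_eqI)
  then show ?thesis
    by (auto simp: has_symbol_def 1 lookup_one value_at_eqI[OF takes_value_1]
        intro: regular_atI[OF takes_value_1])
qed

lemma has_symbol_rfun: "takes_value (v \<circ> Inl) f t \<Longrightarrow> has_symbol v 0 (rfun f) t"
  using has_symbol_rfun_mult[OF _ has_symbol_1] by fastforce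

text \<open>The Leibniz rule read off coefficientwise. The case distinction is forced by truncated
  subtraction of exponents.\<close>

lemma lookup_dleft:
  "Poly_Mapping.lookup (dleft i P) \<beta> =
     (if Poly_Mapping.lookup \<beta> i = 0 then 0
      else Poly_Mapping.lookup P (\<beta> - Poly_Mapping.single i 1))
     + rderiv i (Poly_Mapping.lookup P \<beta>)"
proof (induction P rule: pm_additive_induct)
  case (single \<gamma> f)
  have "\<gamma> + Poly_Mapping.single i 1 = \<beta> \<longleftrightarrow>
      Poly_Mapping.lookup \<beta> i \<noteq> 0 \<and> \<gamma> = \<beta> - Poly_Mapping.single i 1"
    by (auto simp: poly_mapping_eq_iff fun_eq_iff lookup_add lookup_minus lookup_single when_def)
  then show ?case
    by (auto simp: dleft_single lookup_add lookup_single when_def)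
qed (simp_all add: dleft_add lookup_add rderiv_add)

lemma lookup_coeffs_pdop_mult:
  "Poly_Mapping.lookup (coeffs (pdop i * P)) \<beta> =
     (if Poly_Mapping.lookup \<beta> i = 0 then 0
      else Poly_Mapping.lookup (coeffs P) (\<beta> - Poly_Mapping.single i 1))
     + rderiv i (Poly_Mapping.lookup (coeffs P) \<beta>)"
proof -
  have "coeffs (pdop i * P) = dleft i (coeffs P)"
    by transfer (use dleft_pow_Suc[of 0] in \<open>simp add: opmult_single\<close>)
  then show ?thesis by (simp add: lookup_dleft)
qed

text \<open>The Leibniz rule shifts the coefficients by one exponent in direction \<open>i\<close>
  and adds their derivatives. The derivatives do not raise the order, so the shift alone determines
  the symbol and contributes the factor xi_i.\<close>

lemma has_symbol_pdop_mult:
  assumes "has_symbol v d P s"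
  shows "has_symbol v (Suc d) (pdop i * P) (v (Inr i) * s)"
proof -
  let ?x = "v \<circ> Inl" and ?c = "Poly_Mapping.lookup (coeffs P)"
    and ?e = "Poly_Mapping.single i 1 :: 'a \<Rightarrow>\<^sub>0 nat"
    and ?xi = "\<lambda>\<beta>. \<Prod>j\<in>UNIV. v (Inr j) ^ Poly_Mapping.lookup \<beta> j"
  from assms have reg: "regular_at ?x (?c \<beta>)" and ord: "d < mdeg \<beta> \<Longrightarrow> ?c \<beta> = 0"
    and s: "s = (\<Sum>\<beta> | mdeg \<beta> = d. value_at ?x (?c \<beta>) * ?xi \<beta>)" for \<beta>
    by (auto simp: has_symbol_def)
  have shift: "\<beta> - ?e + ?e = \<beta>" if "Poly_Mapping.lookup \<beta> i \<noteq> 0" for \<beta>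
    using that by (auto simp: poly_mapping_eq_iff fun_eq_iff lookup_add lookup_minus lookup_single
        when_def)
  \<comment> \<open>Above order \<open>d\<close> the coefficients of \<open>P\<close> vanish, and so
    do their derivatives: only the shifted coefficient remains.\<close>
  have c: "Poly_Mapping.lookup (coeffs (pdop i * P)) \<beta>
      = (if Poly_Mapping.lookup \<beta> i = 0 then 0 else ?c (\<beta> - ?e))"
    if "d < mdeg \<beta>" for \<beta>
    using ord[OF that] by (simp add: lookup_coeffs_pdop_mult)
  have "(\<Sum>\<beta> | mdeg \<beta> = Suc d.
          value_at ?x (Poly_Mapping.lookup (coeffs (pdop i * P)) \<beta>) * ?xi \<beta>)
      = (\<Sum>\<beta> | mdeg \<beta> = Suc d \<and> Poly_Mapping.lookup \<beta> i \<noteq> 0. value_at ?x (?c (\<beta> - ?e)) * ?xi \<beta>)"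
    by (rule sum.mono_neutral_cong_right) (auto simp: c finite_mdeg_eq)
  also have "\<dots> = (\<Sum>\<beta> | mdeg \<beta> = d. value_at ?x (?c \<beta>) * ?xi (\<beta> + ?e))"
  proof (rule sum.reindex_bij_witness[of _ "\<lambda>\<beta>. \<beta> + ?e" "\<lambda>\<beta>. \<beta> - ?e"])
    fix \<beta> assume "\<beta> \<in> {\<beta>. mdeg \<beta> = Suc d \<and> Poly_Mapping.lookup \<beta> i \<noteq> 0}"
    then show "\<beta> - ?e \<in> {\<beta>. mdeg \<beta> = d}"
      using mdeg_add_single[of "\<beta> - ?e" i] shift[of \<beta>] by auto
  next
    fix \<beta> :: "'a \<Rightarrow>\<^sub>0 nat" assume "\<beta> \<in> {\<beta>. mdeg \<beta> = d}"
    then show "\<beta> + ?e \<in> {\<beta>. mdeg \<beta> = Suc d \<and> Poly_Mapping.lookup \<beta> i \<noteq> 0}"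
      using mdeg_add_single[of \<beta> i] by (simp add: lookup_add)
  qed (simp_all add: shift del: One_nat_def)
  also have "\<dots> = v (Inr i) * s"
    unfolding s by (simp add: prod_power_add_single[simplified] sum_distrib_left algebra_simps)
  finally have "v (Inr i) * s = (\<Sum>\<beta> | mdeg \<beta> = Suc d.
      value_at ?x (Poly_Mapping.lookup (coeffs (pdop i * P)) \<beta>) * ?xi \<beta>)" ..
  moreover have "Poly_Mapping.lookup (coeffs (pdop i * P)) \<beta> = 0" if "Suc d < mdeg \<beta>" for \<beta>
  proof (cases "Poly_Mapping.lookup \<beta> i = 0")
    case False
    then have "d < mdeg (\<beta> - ?e)"
      using that mdeg_add_single[of "\<beta> - ?e" i] shift[of \<beta>] by auto
    with that show ?thesis by (simp add: c ord)
  qed (use that c in simp)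
  moreover have "regular_at ?x (Poly_Mapping.lookup (coeffs (pdop i * P)) \<beta>)" for \<beta>
    by (auto simp: lookup_coeffs_pdop_mult intro!: regular_at_add regular_at_rderiv reg)
  ultimately show ?thesis by (simp add: has_symbol_def)
qed

lemma has_symbol_pdop: "has_symbol v 1 (pdop i) (v (Inr i))"
  using has_symbol_pdop_mult[OF has_symbol_1, of v i] by simp


lemma has_symbol_unique: "has_symbol v d P s \<Longrightarrow> has_symbol v d P t \<Longrightarrow> s = t"
  by (simp add: has_symbol_def)

section \<open>Comparison of symbols with initial forms\<close>

lemma polyfun_poly_coeff:
  assumes "P \<in> weyl"
  shows "polyfun (poly_coeff P \<beta>) = Poly_Mapping.lookup (coeffs P) \<beta>"
proof -
  obtain p where p: "polyfun p = Poly_Mapping.lookup (coeffs P) \<beta>"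
    using assms by (auto simp: weyl_def image_iff) metis
  then show ?thesis
    unfolding poly_coeff_def by (rule theI) (metis p injD[OF inj_polyfun])
qed

lemma coeffs_eq_0_iff: "coeffs P = 0 \<longleftrightarrow> P = 0"
  by transfer simp

lemma op_order_attained:
  assumes "P \<noteq> 0"
  obtains \<beta> where "Poly_Mapping.lookup (coeffs P) \<beta> \<noteq> 0" "mdeg \<beta> = op_order P"
proof -
  have "op_order P \<in> mdeg ` Poly_Mapping.keys (coeffs P)"
    unfolding op_order_def using assms by (intro Max_in) (simp_all add: coeffs_eq_0_iff)
  then show ?thesis using that by (auto simp: in_keys_iff)
qed

lemma coeffs_eq_0_above_order:
  assumes "op_order P < mdeg \<beta>"
  shows "Poly_Mapping.lookup (coeffs P) \<beta> = 0"
proof (rule ccontr)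
  assume "\<not> ?thesis"
  then have "mdeg \<beta> \<le> op_order P"
    unfolding op_order_def by (intro Max_ge) (auto simp: in_keys_iff)
  with assms show False by simp
qed

text \<open>Links the polynomial initial form, which defines the characteristic variety, to the
  pointwise symbol, which also makes sense for rational coefficients.\<close>

lemma has_symbol_in_symbol:
  assumes "P \<in> weyl"
  shows "has_symbol v (op_order P) P (mpoly_eval v (in_symbol P))"
proof -
  let ?x = "v \<circ> Inl" and ?c = "Poly_Mapping.lookup (coeffs P)"
    and ?xi = "\<lambda>\<beta>. \<Prod>i\<in>UNIV. v (Inr i) ^ Poly_Mapping.lookup \<beta> i"
  have val: "takes_value ?x (?c \<beta>) (mpoly_eval ?x (poly_coeff P \<beta>))" for \<beta>
    using takes_value_polyfun[of ?x "poly_coeff P \<beta>"] by (simp add: polyfun_poly_coeff[OF assms])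
  have "mpoly_eval v (in_symbol P) = (\<Sum>\<beta> | \<beta> \<in> Poly_Mapping.keys (coeffs P) \<and> mdeg \<beta> = op_order P.
      mpoly_eval ?x (poly_coeff P \<beta>) * ?xi \<beta>)"
    by (simp add: in_symbol_def mpoly_eval_sum mpoly_eval_mult mpoly_eval_prod mpoly_eval_power
        mpoly_eval_def[of ?x] sum_distrib_right)
  also have "\<dots> = (\<Sum>\<beta> | mdeg \<beta> = op_order P. value_at ?x (?c \<beta>) * ?xi \<beta>)"
    by (rule sum.mono_neutral_cong_left)
      (auto simp only: finite_mdeg_eq value_at_eqI[OF val, symmetric] in_keys_iff value_at_0
        mult_zero_left mem_Collect_eq Diff_iff)
  finally show ?thesis
    unfolding has_symbol_def using regular_atI[OF val] coeffs_eq_0_above_order by blast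
qed


section \<open>Localization of a left ideal at a point\<close>

lemma left_ideal_add: "left_ideal A J \<Longrightarrow> P \<in> J \<Longrightarrow> Q \<in> J \<Longrightarrow> P + Q \<in> J"
  by (simp add: left_ideal_def)

lemma left_ideal_mult: "left_ideal A J \<Longrightarrow> R \<in> A \<Longrightarrow> P \<in> J \<Longrightarrow> R * P \<in> J"
  by (simp add: left_ideal_def)

lemma left_ideal_weyl: "left_ideal weyl weyl"
  by (simp add: left_ideal_def weyl_0 weyl_add weyl_mult)

text \<open>The assumptions make \<open>A\<close> itself a member of the intersected family, so that
  the intersection stays inside \<open>A\<close>.\<close>

lemma left_ideal_left_ideal_gen:
  assumes "left_ideal A A" "S \<subseteq> A"
  shows "left_ideal A (left_ideal_gen A S)"
proof -
  have "left_ideal_gen A S \<subseteq> A"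
    unfolding left_ideal_gen_def using assms by (intro Inter_lower) simp
  then show ?thesis
    unfolding left_ideal_def[of A "left_ideal_gen A S"]
    by (auto simp: left_ideal_gen_def left_ideal_def)
qed

lemma left_ideal_gen_superset: "S \<subseteq> left_ideal_gen A S"
  unfolding left_ideal_gen_def by blast

lemma left_ideal_gen_mono: "S \<subseteq> T \<Longrightarrow> left_ideal_gen A S \<subseteq> left_ideal_gen A T"
  unfolding left_ideal_gen_def by blast

text \<open>Reduces the claim on the Weyl closure to the claim on the ideal.\<close>

lemma char_variety_antimono: "I \<subseteq> J \<Longrightarrow> char_variety J \<subseteq> char_variety I"
proof -
  assume "I \<subseteq> J"
  then have "in_ideal I \<subseteq> in_ideal J"
    unfolding in_ideal_def by (intro left_ideal_gen_mono) blast
  then show ?thesis by (auto simp: char_variety_def zero_set_def)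
qed

lemma char_variety_in_symbol:
  "v \<in> char_variety I \<Longrightarrow> P \<in> I \<Longrightarrow> P \<noteq> 0 \<Longrightarrow> mpoly_eval v (in_symbol P) = 0"
  using left_ideal_gen_superset[of "{in_symbol P | P. P \<in> I \<and> P \<noteq> 0}" UNIV]
  by (auto simp: char_variety_def zero_set_def in_ideal_def)

text \<open>For a left ideal of the Weyl algebra this is its localization at \<open>x\<close>, kept
  inside the ring with rational coefficients: denominators that do not vanish at \<open>x\<close>
  are cleared by \<open>u\<close>.\<close>

definition localized ::
  "('m \<Rightarrow> complex) \<Rightarrow> 'm::{finite,linorder} diffop set \<Rightarrow> 'm diffop set" where
  "localized x I = {P. \<exists>u. mpoly_eval x u \<noteq> 0 \<and> rfun (polyfun u) * P \<in> I}"

text \<open>If \<open>f = p / q\<close> with \<open>q\<close> nonzero at \<open>x\<close>, then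
  \<open>u * q\<close> clears the denominators of the product.\<close>

lemma localized_rfun_mult:
  assumes I: "left_ideal weyl I" and P: "P \<in> localized x I" and f: "regular_at x f"
  shows "rfun f * P \<in> localized x I"
proof -
  obtain u where u: "mpoly_eval x u \<noteq> 0" "rfun (polyfun u) * P \<in> I"
    using P by (auto simp: localized_def)
  obtain p q where q: "mpoly_eval x q \<noteq> 0" "f * polyfun q = polyfun p"
    using f by (auto simp: regular_at_def takes_value_def)
  have "polyfun (u * q) * f = polyfun p * polyfun u"
    by (simp add: polyfun_mult flip: q(2))
  then have "rfun (polyfun (u * q)) * (rfun f * P) = rfun (polyfun p) * (rfun (polyfun u) * P)"
    by (metis mult.assoc rfun_mult)
  also have "\<dots> \<in> I"
    by (intro left_ideal_mult[OF I] weyl_polyfun u(2))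
  finally show ?thesis
    using u(1) q(1) by (auto simp: localized_def mpoly_eval_mult intro!: exI[of _ "u * q"])
qed

text \<open>Rational functions commute, so the product of the two multipliers works for both
  summands.\<close>

lemma localized_add:
  assumes I: "left_ideal weyl I" and "P \<in> localized x I" "Q \<in> localized x I"
  shows "P + Q \<in> localized x I"
proof -
  obtain u where u: "mpoly_eval x u \<noteq> 0" "rfun (polyfun u) * P \<in> I"
    using assms by (auto simp: localized_def)
  obtain w where w: "mpoly_eval x w \<noteq> 0" "rfun (polyfun w) * Q \<in> I"
    using assms by (auto simp: localized_def)
  have "rfun (polyfun w) * (rfun (polyfun u) * P) + rfun (polyfun u) * (rfun (polyfun w) * Q) \<in> I"
    by (intro left_ideal_add[OF I] left_ideal_mult[OF I] weyl_polyfun u(2) w(2))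
  moreover have "rfun (polyfun w) * rfun (polyfun u) = rfun (polyfun (u * w))"
      "rfun (polyfun u) * rfun (polyfun w) = rfun (polyfun (u * w))"
    by (simp_all add: polyfun_mult mult.commute flip: rfun_mult)
  ultimately have "rfun (polyfun (u * w)) * (P + Q) \<in> I"
    by (simp add: distrib_left flip: mult.assoc)
  with u w show ?thesis
    by (auto simp: localized_def mpoly_eval_mult intro!: exI[of _ "u * w"])
qed

lemma localized_diff:
  assumes I: "left_ideal weyl I" and "P \<in> localized x I" "Q \<in> localized x I"
  shows "P - Q \<in> localized x I"
proof -
  have "rfun (- 1) * Q \<in> localized x I"
    by (rule localized_rfun_mult[OF I assms(3) regular_atI[OF takes_value_minus[OF takes_value_1]]])
  from localized_add[OF I assms(2) this] show ?thesis by (simp add: rfun_minus)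
qed

lemma pdop_rfun_mult: "pdop i * (rfun f * P) = rfun f * (pdop i * P) + rfun (rderiv i f) * P"
  by (simp add: pdop_rfun distrib_right flip: mult.assoc)

text \<open>The multiplier \<open>u\<close> need not suffice: moving it past \<open>pdop i\<close>
  leaves a term with the derivative of \<open>u\<close> times \<open>P\<close>. With
  \<open>u * u\<close> this term retains a factor \<open>u\<close> next to \<open>P\<close> and lies
  in \<open>I\<close>.\<close>

lemma localized_pdop_mult:
  assumes I: "left_ideal weyl I" and P: "P \<in> localized x I"
  shows "pdop i * P \<in> localized x I"
proof -
  obtain u where u: "mpoly_eval x u \<noteq> 0" "rfun (polyfun u) * P \<in> I"
    using P by (auto simp: localized_def)
  let ?u = "rfun (polyfun u)" and ?du = "rfun (polyfun (mpderiv i u))"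
  have comm: "?u * ?du = ?du * ?u"
    by (simp add: mult.commute flip: rfun_mult)
  have "pdop i * (?u * (?u * P)) = ?u * (?u * (pdop i * P)) + ?u * (?du * P) + ?du * (?u * P)"
    by (simp add: pdop_rfun_mult rderiv_polyfun distrib_left add_ac)
  also have "?u * (?du * P) = ?du * (?u * P)"
    by (simp add: comm flip: mult.assoc)
  finally have "?u * (?u * (pdop i * P))
      = pdop i * (?u * (?u * P)) - ?du * (?u * P) - ?du * (?u * P)"
    by simp
  also have "\<dots> \<in> I"
  proof -
    have diff: "Q - R \<in> I" if "Q \<in> I" "R \<in> I" for Q R
      using left_ideal_add[OF I that(1) left_ideal_mult[OF I weyl_minus[OF weyl_1] that(2)]]
      by simp
    show ?thesis by (intro diff left_ideal_mult[OF I] u(2) weyl_pdop weyl_polyfun)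
  qed
  finally have "rfun (polyfun (u * u)) * (pdop i * P) \<in> I"
    by (simp add: polyfun_mult rfun_mult mult.assoc)
  with u show ?thesis
    by (auto simp: localized_def mpoly_eval_mult intro!: exI[of _ "u * u"])
qed

text \<open>The multiplier \<open>u\<close> changes the symbol only by its nonzero value and
  produces an element of \<open>I\<close> of order at most \<open>d\<close>. If its order is
  \<open>d\<close>, its initial form vanishes at \<open>v\<close>; if it is smaller or the element
  is 0, there are no terms in degree \<open>d\<close>.\<close>

lemma has_symbol_localized_eq_0:
  assumes v: "v \<in> char_variety I" and I: "left_ideal weyl I"
    and P: "P \<in> localized (v \<circ> Inl) I" and s: "has_symbol v d P s"
  shows "s = 0"
proof -
  obtain u where u: "mpoly_eval (v \<circ> Inl) u \<noteq> 0" "rfun (polyfun u) * P \<in> I"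
    using P by (auto simp: localized_def)
  define Q where "Q = rfun (polyfun u) * P"
  have Q: "has_symbol v d Q (mpoly_eval (v \<circ> Inl) u * s)"
    unfolding Q_def by (rule has_symbol_rfun_mult[OF takes_value_polyfun s])
  have "has_symbol v d Q 0"
  proof (cases "Q = 0")
    case False
    have "Q \<in> I" "Q \<in> weyl"
      using u(2) I by (auto simp: Q_def left_ideal_def)
    then have 0: "has_symbol v (op_order Q) Q 0"
      using has_symbol_in_symbol[of Q v] char_variety_in_symbol[OF v _ False] by simp
    have "op_order Q \<le> d"
      using op_order_attained[OF False] Q unfolding has_symbol_def by (metis not_le)
    with 0 show ?thesis
      by (cases "op_order Q = d") (auto intro: has_symbol_weaken)
  qed (simp add: has_symbol_0)
  from has_symbol_unique[OF Q this] u(1) show ?thesis by simp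
qed


section \<open>Muirhead operators\<close>

lemma left_ideal_muirhead: "left_ideal weyl (muirhead_ideal a c)"
  unfolding muirhead_ideal_def
  by (rule left_ideal_left_ideal_gen[OF left_ideal_weyl]) (auto intro: muirhead_P_in_weyl)

lemma muirhead_P_mem: "muirhead_P a c k \<in> muirhead_ideal a c"
  unfolding muirhead_ideal_def using left_ideal_gen_superset by blast

section \<open>Euler operators\<close>

text \<open>Euler operators commute with one another, and their commutators with coordinates are
  again coordinates or 0. This keeps the elimination for a pair within a few commutation
  rules.\<close>

definition theta :: "'m::{finite,linorder} \<Rightarrow> 'm diffop" where
  "theta i = rfun (xvar i) * pdop i"

lemma theta_rfun: "theta i * rfun f = rfun f * theta i + rfun (xvar i * rderiv i f)"
  by (simp add: theta_def mult.assoc pdop_rfun distrib_left rfun_mult)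
    (simp add: mult.commute flip: mult.assoc rfun_mult)

lemma theta_xvar: "theta i * rfun (xvar j)
    = rfun (xvar j) * theta i + (if i = j then rfun (xvar i) else 0)"
  by (simp add: theta_rfun rderiv_xvar)

lemma theta_commute: "theta i * theta j = theta j * theta i"
proof (cases "i = j")
  case False
  have "theta i * theta j = rfun (xvar i * xvar j) * (pdop i * pdop j)" if "i \<noteq> j" for i j :: 'a
    using that by (simp add: theta_def mult.assoc pdop_rfun_mult rderiv_xvar rfun_mult)
  from this[OF False] this[of j i] False show ?thesis
    by (simp add: pdop_commute[of i j] mult.commute[of "xvar i"])
qed simp

lemma theta_square: "theta i * theta i - theta i = rfun (xvar i * xvar i) * (pdop i * pdop i)"
  by (simp add: theta_def mult.assoc pdop_rfun_mult rderiv_xvar rfun_mult distrib_left)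

lemma has_symbol_theta_mult:
  "has_symbol v d P s \<Longrightarrow> has_symbol v (Suc d) (theta i * P) (v (Inl i) * v (Inr i) * s)"
  using has_symbol_rfun_mult[OF takes_value_xvar[of "v \<circ> Inl" i] has_symbol_pdop_mult[of v d P s i]]
  by (simp add: theta_def mult.assoc)

lemma has_symbol_theta: "has_symbol v 1 (theta i) (v (Inl i) * v (Inr i))"
  using has_symbol_theta_mult[OF has_symbol_1, of v i] by simp

lemma localized_theta_mult:
  "left_ideal weyl I \<Longrightarrow> P \<in> localized x I \<Longrightarrow> theta i * P \<in> localized x I"
  unfolding theta_def mult.assoc
  by (rule localized_rfun_mult[OF _ localized_pdop_mult regular_at_xvar])

section \<open>Order bounds for lower order terms\<close>

text \<open>For terms whose symbol is irrelevant. Regularity of all coefficients at the base point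
  is part of the bound, through \<open>has_symbol\<close>.\<close>

definition order_le :: "('m + 'm \<Rightarrow> complex) \<Rightarrow> nat \<Rightarrow> 'm::{finite,linorder} diffop \<Rightarrow> bool" where
  "order_le v d P \<longleftrightarrow> (\<exists>s. has_symbol v d P s)"

lemma order_leI: "has_symbol v d P s \<Longrightarrow> order_le v d P"
  by (auto simp: order_le_def)

lemma order_le_has_symbol_0: "order_le v d P \<Longrightarrow> d < e \<Longrightarrow> has_symbol v e P 0"
  by (auto simp: order_le_def intro: has_symbol_weaken)

lemma order_le_mono: "order_le v d P \<Longrightarrow> d \<le> e \<Longrightarrow> order_le v e P"
  using order_le_has_symbol_0 order_leI by (metis le_neq_implies_less)

lemma order_le_add: "order_le v d P \<Longrightarrow> order_le v d Q \<Longrightarrow> order_le v d (P + Q)"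
  by (auto simp: order_le_def intro: has_symbol_add)

lemma order_le_diff: "order_le v d P \<Longrightarrow> order_le v d Q \<Longrightarrow> order_le v d (P - Q)"
  by (auto simp: order_le_def intro: has_symbol_diff)

lemma order_le_sum: "(\<And>i. i \<in> A \<Longrightarrow> order_le v d (P i)) \<Longrightarrow> order_le v d (sum P A)"
  by (induction A rule: infinite_finite_induct)
    (auto intro: order_leI has_symbol_0 order_le_add)

lemma order_le_rfun_mult:
  "regular_at (v \<circ> Inl) f \<Longrightarrow> order_le v d P \<Longrightarrow> order_le v d (rfun f * P)"
  by (auto simp: order_le_def regular_at_def intro: has_symbol_rfun_mult)

lemma order_le_theta_mult: "order_le v d P \<Longrightarrow> order_le v (Suc d) (theta i * P)"
  by (auto simp: order_le_def intro: has_symbol_theta_mult)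

lemma order_le_rfun: "regular_at (v \<circ> Inl) f \<Longrightarrow> order_le v d (rfun f)"
  by (auto simp: regular_at_def intro: order_le_mono[OF order_leI[OF has_symbol_rfun]])

lemma order_le_pdop: "order_le v 1 (pdop i)"
  by (rule order_leI[OF has_symbol_pdop])

lemma order_le_theta: "order_le v 1 (theta i)"
  by (rule order_leI[OF has_symbol_theta])

section \<open>Blocks with one element\<close>

text \<open>Since no other coordinate equals that of \<open>k\<close>, all denominators are nonzero
  at the point, and every term except the second derivative has order at most one.\<close>

lemma has_symbol_muirhead_g:
  fixes v :: "'m::{finite,linorder} + 'm \<Rightarrow> complex"
  assumes "\<And>l. l \<noteq> k \<Longrightarrow> v (Inl l) \<noteq> v (Inl k)"
  shows "has_symbol v 2 (muirhead_g a c k) (v (Inl k) * (v (Inr k))\<^sup>2)"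
proof -
  have 1: "has_symbol v 2 (rfun (xvar k) * pdop k ^ 2) (v (Inl k) * (v (Inr k))\<^sup>2)"
    unfolding power2_eq_square
    using has_symbol_rfun_mult[OF takes_value_xvar has_symbol_pdop_mult[OF has_symbol_pdop], of v k k k]
    by (simp add: numeral_2_eq_2)
  have 2: "order_le v 1 (rfun (xvar l / (xvar k - xvar l)) * (pdop k - pdop l))" if "l \<noteq> k" for l
    by (intro order_le_rfun_mult order_le_diff order_le_pdop regular_at_pole regular_at_xvar)
      (simp add: assms that)
  have 3: "order_le v 1 (rfun (cfun c - xvar k) * pdop k)"
    by (intro order_le_rfun_mult order_le_pdop regular_at_diff regular_at_cfun regular_at_xvar)
  have 4: "order_le v 1 (rfun (cfun (1/2)) *
         (\<Sum>l\<in>UNIV - {k}. rfun (xvar l / (xvar k - xvar l)) * (pdop k - pdop l)))"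
    by (intro order_le_rfun_mult order_le_sum 2 regular_at_cfun) auto
  have 5: "order_le v 1 (rfun (cfun a))"
    by (intro order_le_rfun regular_at_cfun)
  have "has_symbol v 2 (muirhead_g a c k) (v (Inl k) * (v (Inr k))\<^sup>2 + 0 + 0 - 0)"
    unfolding muirhead_g_def
    by (intro has_symbol_add has_symbol_diff 1 order_le_has_symbol_0[OF 3]
        order_le_has_symbol_0[OF 4] order_le_has_symbol_0[OF 5]) simp_all
  then show ?thesis by simp
qed

text \<open>The product clearing the denominators of \<open>muirhead_g a c k\<close> does not vanish
  at the point, so this operator itself lies in the localized ideal.\<close>

lemma xi_eq_0_of_singleton_block:
  fixes v :: "'m::{finite,linorder} + 'm \<Rightarrow> complex"
  assumes v: "v \<in> char_variety (muirhead_ideal a c)"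
    and nz: "v (Inl k) \<noteq> 0" and ne: "\<And>l. l \<noteq> k \<Longrightarrow> v (Inl l) \<noteq> v (Inl k)"
  shows "v (Inr k) = 0"
proof -
  define u where "u = (\<Prod>l\<in>UNIV - {k}. Var k - Var l :: 'm mpoly)"
  have "rfun (polyfun u) * muirhead_g a c k \<in> muirhead_ideal a c"
    using muirhead_P_mem[of a c k]
    by (simp add: muirhead_P_def u_def polyfun_prod polyfun_diff xvar_def)
  moreover have "mpoly_eval (v \<circ> Inl) u \<noteq> 0"
    using ne[symmetric] by (auto simp: u_def mpoly_eval_prod mpoly_eval_diff)
  ultimately have "muirhead_g a c k \<in> localized (v \<circ> Inl) (muirhead_ideal a c)"
    by (auto simp: localized_def)
  then have "v (Inl k) * (v (Inr k))\<^sup>2 = 0"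
    by (rule has_symbol_localized_eq_0[OF v left_ideal_muirhead]) (rule has_symbol_muirhead_g, rule ne)
  with nz show ?thesis by simp
qed

section \<open>The elimination identity for a block with two elements\<close>

text \<open>
  The first equation is the combination in which the terms $yST^2$ and $zST$ cancel. In the second,
  $T$ meets $y$ and releases the summand $zM$, which survives on $y = 0$, while the leading term
  $yTS^3$ is removed by $S^2$ times the leading term $yTS$ of $yH$.
\<close>

lemma syzygy_identity:
  fixes S T y z \<alpha> \<alpha>' b C H M E :: "'a::ring_1"
  assumes comm: "T * y = y * T + z" "T * z = z * T + y" "S * y = y * S + y" "S * z = z * S + z"
      "S * T = T * S" "z * y = y * z" "\<alpha> * y = y * \<alpha>" "\<alpha> * z = z * \<alpha>" "T * \<alpha> = \<alpha> * T + \<alpha>'"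
    and H: "H = T * S + \<alpha> * T + y * C"
    and E: "E = S * b + \<alpha> * (S * S + b) - \<alpha>' * T - y * (T * C) - z * C - z * C"
    and M: "M = S * S * S + E"
  shows "y * M = (S - 1 + \<alpha>) * (y * (S * S + T * T + b) + z * T) - T * (y * H)"
    and "T * (y * M) - (S - 1) * ((S - 1) * (y * H))
      = z * M + y * (T * E - S * (S * (\<alpha> * T + y * C)))"
proof -
  \<comment> \<open>The rules with a trailing factor, for use inside longer products. Together with
    \<open>comm\<close> they sort products into the order \<open>y\<close>, \<open>z\<close>,
    \<open>\<alpha>\<close>, \<open>T\<close>, \<open>S\<close>.\<close>
  have comm': "T * (y * w) = y * (T * w) + z * w" "T * (z * w) = z * (T * w) + y * w"
      "S * (y * w) = y * (S * w) + y * w" "S * (z * w) = z * (S * w) + z * w"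
      "S * (T * w) = T * (S * w)" "z * (y * w) = y * (z * w)" "\<alpha> * (y * w) = y * (\<alpha> * w)"
      "\<alpha> * (z * w) = z * (\<alpha> * w)" "T * (\<alpha> * w) = \<alpha> * (T * w) + \<alpha>' * w" for w
    by (simp_all only: mult.assoc[symmetric] comm distrib_right)
  \<comment> \<open>The shift by 1 comes from \<open>S * y = y * S + y\<close>: it makes
    \<open>S - 1\<close> times \<open>y\<close> equal to \<open>y * S\<close>, and likewise for
    \<open>z\<close>.\<close>
  show "y * M = (S - 1 + \<alpha>) * (y * (S * S + T * T + b) + z * T) - T * (y * H)"
    unfolding M E H by (simp add: algebra_simps comm comm')
  show "T * (y * M) - (S - 1) * ((S - 1) * (y * H))
      = z * M + y * (T * E - S * (S * (\<alpha> * T + y * C)))"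
    unfolding M H by (simp add: algebra_simps comm comm')
qed


section \<open>Cancellation of the poles along \<open>x_i = x_j\<close>\<close>

text \<open>The lower order terms of \<open>muirhead_g a c i\<close> without a pole along $x_i = x_j$.\<close>

definition muirhead_tail :: "complex \<Rightarrow> complex \<Rightarrow> 'm \<Rightarrow> 'm \<Rightarrow> 'm::{finite,linorder} diffop" where
  "muirhead_tail a c i j =
     rfun (cfun c - xvar i) * pdop i
     + rfun (cfun (1/2)) *
         (\<Sum>l\<in>UNIV - {i, j}. rfun (xvar l / (xvar i - xvar l)) * (pdop i - pdop l))
     - rfun (cfun a)"

text \<open>The coordinates of \<open>i\<close> and \<open>j\<close> may coincide, because the
  summand for \<open>j\<close> is left out.\<close>

lemma order_le_muirhead_tail:
  fixes v :: "'m::{finite,linorder} + 'm \<Rightarrow> complex"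
  assumes "\<And>l. l \<noteq> i \<Longrightarrow> l \<noteq> j \<Longrightarrow> v (Inl l) \<noteq> v (Inl i)"
  shows "order_le v 1 (muirhead_tail a c i j)"
proof -
  have "order_le v 1 (rfun (xvar l / (xvar i - xvar l)) * (pdop i - pdop l))"
    if "l \<in> UNIV - {i, j}" for l
    using that
    by (intro order_le_rfun_mult order_le_diff order_le_pdop regular_at_pole regular_at_xvar)
      (simp add: assms)
  then have "order_le v 1
      (\<Sum>l\<in>UNIV - {i, j}. rfun (xvar l / (xvar i - xvar l)) * (pdop i - pdop l))"
    by (rule order_le_sum)
  moreover have "order_le v 1 (rfun (cfun a))"
    by (intro order_le_rfun regular_at_cfun)
  ultimately show ?thesis
    unfolding muirhead_tail_def
    by (intro order_le_add order_le_diff order_le_rfun_mult order_le_pdop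
        regular_at_diff regular_at_cfun regular_at_xvar)
qed

lemma muirhead_g_split:
  assumes "i \<noteq> j"
  shows "muirhead_g a c i = rfun (xvar i) * (pdop i * pdop i) + muirhead_tail a c i j
    + rfun (cfun (1/2) * (xvar j / (xvar i - xvar j))) * (pdop i - pdop j)"
proof -
  have "UNIV - {i} = insert j (UNIV - {i, j})" using assms by auto
  then show ?thesis
    by (simp add: muirhead_g_def muirhead_tail_def power2_eq_square distrib_left rfun_mult mult.assoc
        del: times_divide_eq_right)
qed

text \<open>The factor \<open>xvar i\<close> turns derivatives into Euler operators, and
  \<open>xvar i - xvar j\<close> cancels the pole. What the pole leaves behind is antisymmetric in
  \<open>i\<close> and \<open>j\<close>.\<close>

lemma scaled_muirhead_g:
  assumes "i \<noteq> j"
  shows "rfun (xvar i - xvar j) * (rfun (xvar i) * muirhead_g a c i)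
    = rfun (xvar i - xvar j) * (theta i * theta i - theta i + rfun (xvar i) * muirhead_tail a c i j)
      + rfun (cfun (1/2)) * (rfun (xvar j) * theta i - rfun (xvar i) * theta j)"
proof -
  have nz: "xvar i - xvar j \<noteq> 0" using assms by (simp add: xvar_eq_iff)
  have "rfun (xvar i - xvar j) * (rfun (xvar i)
        * (rfun (cfun (1/2) * (xvar j / (xvar i - xvar j))) * (pdop i - pdop j)))
      = rfun ((xvar i - xvar j) * (xvar i * (cfun (1/2) * (xvar j / (xvar i - xvar j)))))
        * (pdop i - pdop j)"
    by (simp only: rfun_mult mult.assoc)
  also have "(xvar i - xvar j) * (xvar i * (cfun (1/2) * (xvar j / (xvar i - xvar j))))
      = cfun (1/2) * (xvar i * xvar j)"
    using nz by simp
  also have "rfun (cfun (1/2) * (xvar i * xvar j)) * (pdop i - pdop j)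
      = rfun (cfun (1/2)) * (rfun (xvar j) * theta i - rfun (xvar i) * theta j)"
    by (simp add: theta_def rfun_mult right_diff_distrib flip: mult.assoc)
      (simp add: mult.assoc mult.commute[of "xvar i"] flip: rfun_mult)
  finally show ?thesis
    unfolding muirhead_g_split[OF assms] theta_square
    by (simp add: distrib_left rfun_mult mult.assoc)
qed

text \<open>Exchanging \<open>i\<close> and \<open>j\<close> in the coefficients changes them by a
  multiple of \<open>xvar i - xvar j\<close>. Up to such multiples both tails therefore have the
  same coefficient \<open>\<phi>\<close>, and \<open>C\<close> collects the quotients.\<close>

lemma muirhead_tail_diff:
  fixes a c :: complex and i j :: "'m::{finite,linorder}"
  assumes "i \<noteq> j"
  defines "\<phi> \<equiv> cfun c - xvar i + cfun (1/2) * (\<Sum>l\<in>UNIV - {i, j}. xvar l / (xvar i - xvar l))"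
    and "C \<equiv> rfun (cfun (1/2)) * (\<Sum>l\<in>UNIV - {i, j}.
        rfun (xvar l / ((xvar i - xvar l) * (xvar j - xvar l))) * (theta l - theta j))
      - theta j - rfun (cfun a)"
  shows "rfun (xvar i) * muirhead_tail a c i j - rfun (xvar j) * muirhead_tail a c j i
    = rfun \<phi> * (theta i - theta j) + rfun (xvar i - xvar j) * C"
proof -
  let ?L = "UNIV - {i, j}"
  let ?h = "rfun (cfun (1/2)) :: 'm diffop" and ?y = "rfun (xvar i - xvar j)"
  \<comment> \<open>Based on \<open>x_k x_l (d_k - d_l) = x_l theta_k - x_k theta_l\<close>, where
    \<open>d\<close> denotes the partial derivative.\<close>
  have scaled: "rfun (xvar k) * muirhead_tail a c k k'
      = rfun (cfun c - xvar k) * theta k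
        + ?h * (\<Sum>l\<in>UNIV - {k, k'}. rfun (xvar l / (xvar k - xvar l)) * theta k
            - rfun (xvar k / (xvar k - xvar l)) * theta l)
        - rfun (xvar k) * rfun (cfun a)" for k k'
  proof -
    have 1: "rfun (xvar k) * (rfun (xvar l / (xvar k - xvar l)) * (pdop k - pdop l))
        = rfun (xvar l / (xvar k - xvar l)) * theta k - rfun (xvar k / (xvar k - xvar l)) * theta l"
      for l
      unfolding theta_def right_diff_distrib mult.assoc[symmetric] rfun_mult[symmetric]
      by (simp add: mult.commute)
    have 2: "rfun (xvar k) * (?h * P) = ?h * (rfun (xvar k) * P)" for P
      unfolding mult.assoc[symmetric] rfun_mult[symmetric] by (simp add: mult.commute)
    have 3: "rfun (xvar k) * (rfun (cfun c - xvar k) * pdop k)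
        = rfun (cfun c - xvar k) * theta k"
      unfolding theta_def mult.assoc[symmetric] rfun_mult[symmetric] by (simp add: mult.commute)
    have "X * (P + Q - R) = X * P + X * Q - X * R" for X P Q R :: "'m diffop"
      by (simp add: algebra_simps)
    then show ?thesis
      by (simp only: muirhead_tail_def 1 2 3 sum_distrib_left[of "rfun (xvar k)"])
  qed
  have summand: "(rfun (xvar l / (xvar i - xvar l)) * theta i
          - rfun (xvar i / (xvar i - xvar l)) * theta l)
        - (rfun (xvar l / (xvar j - xvar l)) * theta j
          - rfun (xvar j / (xvar j - xvar l)) * theta l)
      = rfun (xvar l / (xvar i - xvar l)) * (theta i - theta j)
        + ?y * (rfun (xvar l / ((xvar i - xvar l) * (xvar j - xvar l))) * (theta l - theta j))"
    if "l \<in> ?L" for l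
  proof -
    let ?r = "(xvar i - xvar j) * (xvar l / ((xvar i - xvar l) * (xvar j - xvar l)))"
    have nz: "xvar i - xvar l \<noteq> 0" "xvar j - xvar l \<noteq> 0"
      using that by (auto simp: xvar_eq_iff)
    \<comment> \<open>Applied with \<open>p = x_i - x_l\<close> and \<open>q = x_j - x_l\<close>, so
      that \<open>p - q\<close> is the desired factor \<open>x_i - x_j\<close>.\<close>
    have "r / q = r / p + (p - q) * (r / (p * q))" if "p \<noteq> 0" "q \<noteq> 0" for p q r :: "'m ratfun"
      using that by (simp add: field_simps)
    from this[OF nz, of "xvar l"]
    have j: "xvar l / (xvar j - xvar l) = xvar l / (xvar i - xvar l) + ?r" by simp
    \<comment> \<open>Hence the coefficients of \<open>theta l\<close> and of \<open>theta j\<close>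
      receive the same correction \<open>?r\<close>, with opposite signs.\<close>
    have e: "xvar k / (xvar k - xvar l) = 1 + xvar l / (xvar k - xvar l)"
      if "xvar k - xvar l \<noteq> 0" for k
      using that by (simp add: field_simps)
    have l: "xvar j / (xvar j - xvar l) = xvar i / (xvar i - xvar l) + ?r"
      unfolding e[OF nz(1)] e[OF nz(2)] j by (simp only: add.assoc)
    show ?thesis
      unfolding j l rfun_add mult.assoc[symmetric] rfun_mult[symmetric]
      by (simp add: algebra_simps)
  qed
  have L: "UNIV - {j, i} = ?L" by auto
  have "rfun (xvar i) * muirhead_tail a c i j - rfun (xvar j) * muirhead_tail a c j i
      = rfun (cfun c - xvar i) * theta i - rfun (cfun c - xvar j) * theta j
        + ?h * (\<Sum>l\<in>?L. (rfun (xvar l / (xvar i - xvar l)) * theta i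
            - rfun (xvar i / (xvar i - xvar l)) * theta l)
          - (rfun (xvar l / (xvar j - xvar l)) * theta j
            - rfun (xvar j / (xvar j - xvar l)) * theta l))
        - ?y * rfun (cfun a)"
    unfolding scaled L sum_subtractf by (simp add: algebra_simps rfun_diff)
  also have "\<dots> = rfun (cfun c - xvar i) * (theta i - theta j) - ?y * theta j
        + ?h * (rfun (\<Sum>l\<in>?L. xvar l / (xvar i - xvar l)) * (theta i - theta j)
          + ?y * (\<Sum>l\<in>?L. rfun (xvar l / ((xvar i - xvar l) * (xvar j - xvar l)))
              * (theta l - theta j)))
        - ?y * rfun (cfun a)"
  proof -
    have "rfun (sum f A) = (\<Sum>l\<in>A. rfun (f l))" for f :: "'m \<Rightarrow> 'm ratfun" and A
      by (induction A rule: infinite_finite_induct) (simp_all add: rfun_add)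
    then show ?thesis
      by (simp add: summand sum.distrib sum_distrib_left sum_distrib_right)
        (simp add: algebra_simps rfun_diff)
  qed
  also have "\<dots> = rfun \<phi> * (theta i - theta j) + ?y * C"
  proof -
    have "?h * (?y * P) = ?y * (?h * P)" for P
      unfolding mult.assoc[symmetric] rfun_mult[symmetric] by (simp add: mult.commute)
    then show ?thesis
      by (simp add: \<phi>_def C_def distrib_left right_diff_distrib rfun_add rfun_mult mult.assoc
          distrib_right)
  qed
  finally show ?thesis .
qed


section \<open>Blocks with two elements\<close>

text \<open>Among the factors of the product in \<open>muirhead_P a c i\<close> only
  \<open>xvar i - xvar j\<close> may vanish at the point; the others are absorbed by the
  localization.\<close>

lemma scaled_muirhead_mem:
  fixes v :: "'m::{finite,linorder} + 'm \<Rightarrow> complex"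
  assumes "i \<noteq> j" and ne: "\<And>l. l \<noteq> i \<Longrightarrow> l \<noteq> j \<Longrightarrow> v (Inl l) \<noteq> v (Inl i)"
  shows "rfun (xvar i - xvar j) * (rfun (xvar i) * muirhead_g a c i)
    \<in> localized (v \<circ> Inl) (muirhead_ideal a c)"
proof -
  define u where "u = (\<Prod>l\<in>UNIV - {i} - {j}. Var i - Var l :: 'm mpoly)"
  have "(\<Prod>l\<in>UNIV - {i}. xvar i - xvar l) = polyfun u * (xvar i - xvar j)"
    using assms(1) by (subst prod.remove[of _ j])
      (simp_all add: u_def polyfun_prod polyfun_diff xvar_def)
  then have "rfun (polyfun u) * (rfun (xvar i - xvar j) * muirhead_g a c i) \<in> muirhead_ideal a c"
    using muirhead_P_mem[of a c i] by (simp add: muirhead_P_def rfun_mult mult.assoc)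
  moreover have "mpoly_eval (v \<circ> Inl) u \<noteq> 0"
    using ne[symmetric] by (auto simp: u_def mpoly_eval_prod mpoly_eval_diff)
  ultimately have "rfun (xvar i - xvar j) * muirhead_g a c i
      \<in> localized (v \<circ> Inl) (muirhead_ideal a c)"
    by (auto simp: localized_def)
  from localized_rfun_mult[OF left_ideal_muirhead this regular_at_xvar[of _ i]]
  have "rfun (xvar i) * (rfun (xvar i - xvar j) * muirhead_g a c i)
      \<in> localized (v \<circ> Inl) (muirhead_ideal a c)" .
  moreover have "rfun (xvar i) * (rfun (xvar i - xvar j) * P)
      = rfun (xvar i - xvar j) * (rfun (xvar i) * P)" for P
    unfolding mult.assoc[symmetric] rfun_mult[symmetric] by (simp add: mult.commute)
  ultimately show ?thesis by simp
qed

text \<open>The syzygy gives an element of the localized ideal of order at most three whose symbol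
  is a nonzero multiple of the cube of the sum in question.\<close>

lemma xi_sum_eq_0_of_pair_block:
  fixes v :: "'m::{finite,linorder} + 'm \<Rightarrow> complex"
  assumes v: "v \<in> char_variety (muirhead_ideal a c)" and "i \<noteq> j"
    and nz: "v (Inl i) \<noteq> 0" and eq: "v (Inl j) = v (Inl i)"
    and ne: "\<And>l. l \<noteq> i \<Longrightarrow> l \<noteq> j \<Longrightarrow> v (Inl l) \<noteq> v (Inl i)"
  shows "v (Inr i) + v (Inr j) = 0"
proof -
  let ?I = "localized (v \<circ> Inl) (muirhead_ideal a c)"
  define y z where "y = rfun (xvar i - xvar j)" and "z = rfun (xvar i + xvar j)"
  define S T where "S = theta i + theta j" and "T = theta i - theta j"
  define Bi Bj where "Bi = rfun (xvar i) * muirhead_tail a c i j"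
    and "Bj = rfun (xvar j) * muirhead_tail a c j i"
  define \<phi> where "\<phi> = cfun c - xvar i
    + cfun (1/2) * (\<Sum>l\<in>UNIV - {i, j}. xvar l / (xvar i - xvar l))"
  define C where "C = rfun (cfun (1/2)) * (\<Sum>l\<in>UNIV - {i, j}.
        rfun (xvar l / ((xvar i - xvar l) * (xvar j - xvar l))) * (theta l - theta j))
      - theta j - rfun (cfun a)"
  \<comment> \<open>The \<open>- 1\<close> comes from the linear parts \<open>- theta i\<close> and
    \<open>- theta j\<close>, whose difference is \<open>- T\<close>. The function in
    \<open>\<alpha>'\<close> is the derivative giving the commutator of \<open>T\<close> with
    \<open>\<alpha>\<close>.\<close>
  define \<alpha> \<alpha>' where "\<alpha> = rfun (\<phi> - 1)"
    and "\<alpha>' = rfun (xvar i * rderiv i (\<phi> - 1) - xvar j * rderiv j (\<phi> - 1))"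
  define b where "b = Bi + Bi + Bj + Bj - S - S - S"
  define H where "H = T * S + \<alpha> * T + y * C"
  define E where "E = S * b + \<alpha> * (S * S + b) - \<alpha>' * T - y * (T * C) - z * C - z * C"
  define M where "M = S * S * S + E"
  define Wi Wj where "Wi = y * (rfun (xvar i) * muirhead_g a c i)"
    and "Wj = y * (rfun (xvar j) * muirhead_g a c j)"

  have ne': "v (Inl l) \<noteq> v (Inl j)" if "l \<noteq> i" "l \<noteq> j" for l
    using ne[OF that] eq by simp
  have neg_y: "rfun (xvar j - xvar i) = - y"
    by (simp add: y_def flip: rfun_minus)
  let ?h = "rfun (cfun (1/2)) :: 'm diffop"
    and ?D = "rfun (xvar j) * theta i - rfun (xvar i) * theta j"
  have Wi: "Wi = y * (theta i * theta i - theta i + Bi) + ?h * ?D"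
    unfolding Wi_def y_def Bi_def by (rule scaled_muirhead_g[OF \<open>i \<noteq> j\<close>])
  \<comment> \<open>Exchanging \<open>i\<close> and \<open>j\<close> reverses the signs of both
    \<open>y\<close> and \<open>?D\<close>. So \<open>Wi\<close> and \<open>Wj\<close> share the
    summand \<open>?h * ?D\<close>, which cancels in their difference.\<close>
  have Wj: "Wj = y * (theta j * theta j - theta j + Bj) + ?h * ?D"
    using scaled_muirhead_g[OF \<open>i \<noteq> j\<close>[symmetric], of a c]
    by (simp add: Wj_def Bj_def neg_y algebra_simps)
  have B: "Bi - Bj = rfun \<phi> * T + y * C"
    unfolding Bi_def Bj_def T_def y_def C_def \<phi>_def by (rule muirhead_tail_diff[OF \<open>i \<noteq> j\<close>])
  have half: "?h * P + ?h * P = P" for P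
  proof -
    have "cfun (1/2) + cfun (1/2) = (1 :: 'm ratfun)"
      by (simp add: cfun_def Const_def flip: polyfun_add single_add)
    then show ?thesis by (simp flip: distrib_right rfun_add)
  qed

  have "Wi - Wj = y * H"
  proof -
    have "\<alpha> * T = rfun \<phi> * T - T"
      by (simp add: \<alpha>_def rfun_diff left_diff_distrib)
    then have "H = T * S - T + (Bi - Bj)"
      by (simp add: H_def B)
    also have "T * S = theta i * theta i - theta j * theta j"
      by (simp add: S_def T_def algebra_simps theta_commute)
    finally have H': "H = theta i * theta i - theta j * theta j - T + (Bi - Bj)" .
    show ?thesis
      unfolding H' Wi Wj T_def by (simp add: algebra_simps)
  qed
  \<comment> \<open>The sum is doubled because \<open>S * S + T * T\<close> is twice the sum of the
    squares of the two Euler operators.\<close>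
  moreover have "Wi + Wi + Wj + Wj = y * (S * S + T * T + b) + z * T"
  proof -
    have "Wi + Wi + Wj + Wj = y * (theta i * theta i + theta i * theta i
          + theta j * theta j + theta j * theta j - S - S + (Bi + Bi + Bj + Bj))
        + (?h * ?D + ?h * ?D) + (?h * ?D + ?h * ?D)"
      by (simp add: Wi Wj S_def algebra_simps)
    also have "\<dots> = y * (theta i * theta i + theta i * theta i
          + theta j * theta j + theta j * theta j - S - S + (Bi + Bi + Bj + Bj)) + (?D + ?D)"
      by (simp only: half add.assoc)
    \<comment> \<open>The part \<open>- y * S\<close> supplies one of the three copies of
      \<open>S\<close> subtracted in \<open>b\<close>; the other two come from
      \<open>- theta i\<close> and \<open>- theta j\<close>.\<close>
    also have "?D + ?D = z * T - y * S"
      by (simp add: z_def y_def S_def T_def rfun_add rfun_diff algebra_simps)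
    also have "theta i * theta i + theta i * theta i + theta j * theta j + theta j * theta j
        = S * S + T * T"
      by (simp add: S_def T_def algebra_simps)
    finally show ?thesis
      by (simp add: b_def algebra_simps)
  qed
  moreover have "Wi \<in> ?I"
    unfolding Wi_def y_def by (rule scaled_muirhead_mem[OF \<open>i \<noteq> j\<close>]) (rule ne)
  moreover have "Wj \<in> ?I"
  proof -
    have "- Wj \<in> ?I"
      using scaled_muirhead_mem[OF \<open>i \<noteq> j\<close>[symmetric], of v a c] ne' by (simp add: Wj_def neg_y)
    from localized_rfun_mult[OF left_ideal_muirhead this
        regular_atI[OF takes_value_minus[OF takes_value_1]]]
    show ?thesis by (simp add: rfun_minus)
  qed
  ultimately have yH: "y * H \<in> ?I" and yN: "y * (S * S + T * T + b) + z * T \<in> ?I"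
    by (metis localized_diff localized_add left_ideal_muirhead)+

  have S_mem: "S * P \<in> ?I" and T_mem: "T * P \<in> ?I" if "P \<in> ?I" for P
    using localized_theta_mult[OF left_ideal_muirhead that]
    by (simp_all add: S_def T_def distrib_right left_diff_distrib
        localized_add[OF left_ideal_muirhead] localized_diff[OF left_ideal_muirhead])
  \<comment> \<open>The sum in \<open>\<phi>\<close> omits the index \<open>j\<close>, so there is
    no pole although the coordinates of \<open>i\<close> and \<open>j\<close> agree.\<close>
  have t: "regular_at (v \<circ> Inl) (\<phi> - 1)"
    unfolding \<phi>_def
    by (intro regular_at_diff regular_at_add regular_at_mult regular_at_sum regular_at_pole
        regular_at_cfun regular_at_xvar regular_at_1) (use ne in auto)
  have t': "regular_at (v \<circ> Inl) (xvar i * rderiv i (\<phi> - 1) - xvar j * rderiv j (\<phi> - 1))"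
    by (intro regular_at_diff[of _ "_ * _"] regular_at_mult regular_at_rderiv regular_at_xvar t)

  have "T * y = y * T + z" "T * z = z * T + y" "S * y = y * S + y" "S * z = z * S + z"
    using \<open>i \<noteq> j\<close>
    by (simp_all add: S_def T_def y_def z_def rfun_add rfun_diff theta_xvar algebra_simps)
  moreover have "S * T = T * S"
    by (simp add: S_def T_def algebra_simps theta_commute)
  moreover have "z * y = y * z" "\<alpha> * y = y * \<alpha>" "\<alpha> * z = z * \<alpha>"
    by (simp_all add: y_def z_def \<alpha>_def mult.commute flip: rfun_mult)
  moreover have "T * \<alpha> = \<alpha> * T + \<alpha>'"
  proof -
    have "T * rfun f = rfun f * T + rfun (xvar i * rderiv i f - xvar j * rderiv j f)" for f
      by (simp add: T_def theta_rfun rfun_diff algebra_simps)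
    then show ?thesis unfolding \<alpha>_def \<alpha>'_def .
  qed
  ultimately have yM_eq: "y * M = (S - 1 + \<alpha>) * (y * (S * S + T * T + b) + z * T) - T * (y * H)"
    and R_eq: "T * (y * M) - (S - 1) * ((S - 1) * (y * H))
      = z * M + y * (T * E - S * (S * (\<alpha> * T + y * C)))"
    using H_def E_def M_def by (rule syzygy_identity)+

  have yM: "y * M \<in> ?I"
    unfolding yM_eq using yN yH
    by (simp add: distrib_right left_diff_distrib S_mem T_mem \<alpha>_def
        localized_rfun_mult[OF left_ideal_muirhead _ t]
        localized_add[OF left_ideal_muirhead] localized_diff[OF left_ideal_muirhead]
        del: distrib_left)
  have S1_mem: "(S - 1) * P \<in> ?I" if "P \<in> ?I" for P
    using that by (simp add: left_diff_distrib S_mem localized_diff[OF left_ideal_muirhead])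
  have R_mem: "z * M + y * (T * E - S * (S * (\<alpha> * T + y * C))) \<in> ?I"
    unfolding R_eq[symmetric]
    by (intro localized_diff[OF left_ideal_muirhead] T_mem S1_mem yM yH)

  have S_ord: "order_le v (Suc d) (S * P)" and T_ord: "order_le v (Suc d) (T * P)"
    if "order_le v d P" for d P
    using order_le_theta_mult[OF that]
    by (simp_all add: S_def T_def distrib_right left_diff_distrib order_le_add order_le_diff)
  have S1: "order_le v 1 S" and T1: "order_le v 1 T"
    unfolding S_def T_def by (intro order_le_add order_le_diff order_le_theta)+
  \<comment> \<open>The equality of the two coordinates enters here: \<open>y\<close> takes the
    value 0 and removes the symbol of whatever it multiplies, while \<open>z\<close> takes a nonzero
    value.\<close>
  have y_val: "takes_value (v \<circ> Inl) (xvar i - xvar j) 0"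
    using takes_value_diff[OF takes_value_xvar takes_value_xvar, of "v \<circ> Inl" i j] eq by simp
  have z_val: "takes_value (v \<circ> Inl) (xvar i + xvar j) (2 * v (Inl i))"
    using takes_value_add[OF takes_value_xvar takes_value_xvar, of "v \<circ> Inl" i j] eq by simp
  have y_ord: "order_le v d (y * P)" and z_ord: "order_le v d (z * P)"
    and \<alpha>_ord: "order_le v d (\<alpha> * P)" and \<alpha>'_ord: "order_le v d (\<alpha>' * P)"
    if "order_le v d P" for d P
    unfolding y_def z_def \<alpha>_def \<alpha>'_def
    by (rule order_le_rfun_mult[OF _ that], rule regular_atI[OF y_val] regular_atI[OF z_val] t t')+
  have C1: "order_le v 1 C"
  proof -
    have "order_le v 1 (rfun (xvar l / ((xvar i - xvar l) * (xvar j - xvar l))) * (theta l - theta j))"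
      if "l \<in> UNIV - {i, j}" for l
    proof -
      \<comment> \<open>As an iterated quotient the coefficient is regular by two uses of
        \<open>regular_at_pole\<close>.\<close>
      have "xvar l / ((xvar i - xvar l) * (xvar j - xvar l))
          = xvar l / (xvar i - xvar l) / (xvar j - xvar l)" by simp
      then show ?thesis
        using that ne[of l] ne'[of l]
        by (simp only:) (intro order_le_rfun_mult order_le_diff order_le_theta regular_at_pole
            regular_at_xvar; simp)
    qed
    then have "order_le v 1 (\<Sum>l\<in>UNIV - {i, j}.
        rfun (xvar l / ((xvar i - xvar l) * (xvar j - xvar l))) * (theta l - theta j))"
      by (rule order_le_sum)
    moreover have "order_le v 1 (rfun (cfun a))"
      by (intro order_le_rfun regular_at_cfun)
    ultimately show ?thesis
      unfolding C_def
      by (intro order_le_diff order_le_rfun_mult order_le_theta regular_at_cfun)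
  qed
  have "order_le v 1 Bi" "order_le v 1 Bj"
    unfolding Bi_def Bj_def
    by (intro order_le_rfun_mult regular_at_xvar order_le_muirhead_tail; use ne ne' in auto)+
  then have b1: "order_le v 1 b"
    unfolding b_def by (intro order_le_add order_le_diff S1)
  \<comment> \<open>Up to regular coefficients, each summand of \<open>E\<close> has at most two
    factors, each of order at most one, so \<open>S * S * S\<close> alone determines the symbol of
    \<open>M\<close> in order 3.\<close>
  have E2: "order_le v 2 E"
  proof -
    have *: "order_le v 2 b" "order_le v 2 T" "order_le v 2 C"
      by (rule order_le_mono[OF b1] order_le_mono[OF T1] order_le_mono[OF C1]; simp)+
    have "order_le v 2 (S * b)" "order_le v 2 (S * S)" "order_le v 2 (T * C)"
      using S_ord[OF b1] S_ord[OF S1] T_ord[OF C1] by (simp_all add: numeral_2_eq_2)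
    with * show ?thesis
      unfolding E_def by (intro order_le_add order_le_diff \<alpha>_ord \<alpha>'_ord y_ord z_ord)
  qed
  have S_sym: "has_symbol v (Suc d) (S * P) (v (Inl i) * (v (Inr i) + v (Inr j)) * s)"
    if "has_symbol v d P s" for d P s
    using has_symbol_add[OF has_symbol_theta_mult[OF that, of i] has_symbol_theta_mult[OF that, of j]]
    by (simp add: S_def distrib_right eq algebra_simps)
  let ?s = "v (Inl i) * (v (Inr i) + v (Inr j))"
  have "has_symbol v 3 (S * (S * (S * 1))) (?s * (?s * (?s * 1)))"
    using S_sym[OF S_sym[OF S_sym[OF has_symbol_1]]] by (simp add: numeral_3_eq_3)
  then have "has_symbol v 3 M (?s * (?s * (?s * 1)) + 0)"
    unfolding M_def by (intro has_symbol_add order_le_has_symbol_0[OF E2]) (simp_all add: mult.assoc)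
  then have zM: "has_symbol v 3 (z * M) (2 * v (Inl i) * (?s * (?s * (?s * 1)) + 0))"
    unfolding z_def by (rule has_symbol_rfun_mult[OF z_val])
  have "order_le v 3 (T * E - S * (S * (\<alpha> * T + y * C)))"
    using T_ord[OF E2] S_ord[OF S_ord[OF order_le_add[OF \<alpha>_ord[OF T1] y_ord[OF C1]]]]
    by (intro order_le_diff) (simp_all add: numeral_3_eq_3 numeral_2_eq_2)
  then obtain r where "has_symbol v 3 (T * E - S * (S * (\<alpha> * T + y * C))) r"
    by (auto simp: order_le_def)
  from has_symbol_rfun_mult[OF y_val this]
  have "has_symbol v 3 (y * (T * E - S * (S * (\<alpha> * T + y * C)))) (0 * r)"
    unfolding y_def .
  \<comment> \<open>The resulting equation says that twice the coordinate times the cube of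
    \<open>?s\<close> is 0; the coordinate is nonzero, so the sum of the two xi is 0.\<close>
  from has_symbol_localized_eq_0[OF v left_ideal_muirhead R_mem has_symbol_add[OF zM this]] nz
  show ?thesis by simp
qed

section \<open>The covering by linear spaces\<close>

theorem proposition6p3:
  fixes a c :: complex
  shows "char_variety (muirhead_ideal a c :: 'm::{finite,linorder} diffop set)
           \<subseteq> (\<Union>(J0, \<J>) \<in> {(J0, \<J>). partition_on (UNIV - J0) \<J>}. C_hat J0 \<J>)
       \<and> char_variety (weyl_closure (muirhead_ideal a c :: 'm diffop set))
           \<subseteq> (\<Union>(J0, \<J>) \<in> {(J0, \<J>). partition_on (UNIV - J0) \<J>}. C_hat J0 \<J>)"
proof -
  let ?I = "muirhead_ideal a c :: 'm diffop set"
  have main: "char_variety ?I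
      \<subseteq> (\<Union>(J0, \<J>) \<in> {(J0, \<J>). partition_on (UNIV - J0) \<J>}. C_hat J0 \<J>)"
  proof
    fix v assume v: "v \<in> char_variety ?I"
    define J0 where "J0 = {j :: 'm. v (Inl j) = 0}"
    define block where "block i = {j :: 'm. v (Inl j) = v (Inl i)}" for i
    define \<J> where "\<J> = block ` (UNIV - J0)"
    have "partition_on (UNIV - J0) \<J>"
      \<comment> \<open>The blocks are the fibres of the coordinates over nonzero values, hence
        nonempty and pairwise disjoint.\<close>
      by (rule partition_onI) (auto simp: \<J>_def block_def J0_def disjnt_def)
    moreover have "v \<in> C_hat J0 \<J>"
    proof -
      have xi: "(\<Sum>i\<in>J. v (Inr i)) = 0" if J: "J \<in> \<J>" and card: "card J \<le> 2" for J
      proof -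
        obtain i where i: "v (Inl i) \<noteq> 0" "J = block i"
          using J unfolding \<J>_def J0_def by blast
        then have "i \<in> J" by (simp add: block_def)
        with card have "card (J - {i}) \<le> 1" by simp
        \<comment> \<open>The bound on the size of \<open>J\<close> leaves at most one further
          index, so the two block lemmas cover all cases.\<close>
        then consider "J - {i} = {}" | j where "J - {i} = {j}"
          by (metis card_0_eq card_1_singletonE finite le_neq_implies_less less_one)
        then show ?thesis
        proof cases
          case 1
          then have "J = {i}" using \<open>i \<in> J\<close> by auto
          moreover have "v (Inr i) = 0"
            using 1 i by (intro xi_eq_0_of_singleton_block[OF v]) (auto simp: block_def)
          ultimately show ?thesis by simp
        next
          case 2
          then have ij: "J = {i, j}" "i \<noteq> j" using \<open>i \<in> J\<close> by auto
          have "v (Inr i) + v (Inr j) = 0"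
            using ij i by (intro xi_sum_eq_0_of_pair_block[OF v]) (auto simp: block_def)
          with ij show ?thesis by simp
        qed
      qed
      have x: "v (Inl i) = v (Inl j)" if "J \<in> \<J>" "i \<in> J" "j \<in> J" for i j J
        using that by (auto simp: \<J>_def block_def)
      have "mpoly_eval v p = 0"
        if "p \<in> {Var (Inl j) | j. j \<in> J0}
              \<union> (\<Union>J\<in>\<J>. {Var (Inl i) - Var (Inl j) | i j. i \<in> J \<and> j \<in> J})
              \<union> {\<Sum>i\<in>J. Var (Inr i) | J. J \<in> \<J> \<and> card J \<le> 2}" for p
      proof -
        from that consider j where "p = Var (Inl j)" "j \<in> J0"
          | J i j where "p = Var (Inl i) - Var (Inl j)" "J \<in> \<J>" "i \<in> J" "j \<in> J"
          | J where "p = (\<Sum>i\<in>J. Var (Inr i))" "J \<in> \<J>" "card J \<le> 2"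
          by blast
        then show ?thesis
        proof cases
          case 1
          then show ?thesis by (simp add: J0_def)
        next
          case 2
          with x[OF 2(2-4)] show ?thesis by (simp add: mpoly_eval_diff)
        next
          case 3
          with xi[OF 3(2,3)] show ?thesis by (simp add: mpoly_eval_sum)
        qed
      qed
      then show ?thesis unfolding C_hat_def zero_set_def by (intro CollectI ballI)
    qed
    ultimately show "v \<in> (\<Union>(J0, \<J>) \<in> {(J0, \<J>). partition_on (UNIV - J0) \<J>}. C_hat J0 \<J>)"
      by blast
  qed
  \<comment> \<open>Elements of \<open>?I\<close> have polynomial coefficients and lie in the left
    ideal that \<open>?I\<close> generates over the larger ring.\<close>
  have "?I \<subseteq> weyl_closure ?I"
    using left_ideal_muirhead[of a c] left_ideal_gen_superset[of ?I UNIV]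
    by (auto simp: weyl_closure_def left_ideal_def)
  with main show ?thesis
    using char_variety_antimono by blast
qed

end
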